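(* Let $V\in\mathcal{S}$ and assume that there is an open set $O\subset\mathbb{S}^{d-1}$ such that 1. $\mathbb{S}^{d-1}\setminus O$ has exactly two connected components $F^-$ and $F^+$, with $\xi^\pm\in F^\pm$; 2. $\displaystyle\sqrt{2\min_{s\in\overline{O}}(V(s)-V_{\min})}\cdot\mathrm{dist}(F^-,F^+)>2\sqrt{2V_{\min}}$. Then $V\in\Sigma$.
   Context: Let $d\ge 2$ and let $\mathbb{S}^{d-1}$ be the unit sphere of $\mathbb{R}^d$. Fix $\xi^+\neq\xi^-$ in $\mathbb{S}^{d-1}$ and a real number $V_{\min}>0$. Let $\mathcal{S}$ be the set of $V\in C^2(\mathbb{S}^{d-1})$ such that $V(s)\ge V(\xi^\pm)=V_{\min}$ for all $s\in\mathbb{S}^{d-1}$ and there exist $\delta>0$, $\mu>0$ such that $|s-\xi^\pm|<\delta$ implies $V(s)-V(\xi^\pm)\ge\mu|s-\xi^\pm|^2$ (for $s\in\mathbb{S}^{d-1}$). For $V\in\mathcal{S}$ and $\alpha\in(0,2)$, the pair $(V,\alpha)$ is identified with the potential $V(x)=V(x/|x|)/|x|^\alpha$ on $\mathbb{R}^d\setminus\{0\}$ (with value $+\infty$ at $0$). Put $\alpha_*=(2-\alpha)/2$. Distances between points of the sphere are Euclidean: $\mathrm{dist}(F^-,F^+)=\inf\{|s-s'|: s\in F^-,\ s'\in F^+\}$. Action for $(V,\alpha)$: $\mathcal{A}([a,b];x)=\int_a^b\left(\frac12|\dot x|^2+V(x)\right)dt$ for $x\in H^1((a,b);\mathbb{R}^d)$.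 For $\varepsilon\in(0,1]$, $m((V,\alpha),\varepsilon)=\inf\{\mathcal{A}([-T,T];x): T>0,\ x\in H^1((-T,T);\mathbb{R}^d),\ x(-T)=\xi^-,\ x(T)=\xi^+,\ \min_{[-T,T]}|x|=\varepsilon\}$; $m((V,\alpha),0)=\frac{2}{\alpha_*}\sqrt{2V_{\min}}$; $\gamma((V,\alpha),\varepsilon)=\dfrac{m((V,\alpha),\varepsilon)-m((V,\alpha),0)}{\varepsilon^{\alpha_*}}$; $\gamma((V,\alpha),0^+)=\lim_{\varepsilon\to0^+}\gamma((V,\alpha),\varepsilon)$ (which exists in $\{-\infty\}\cup\mathbb{R}$ since $\gamma$ is increasing in $\varepsilon$); $\gamma((V,0^+),0^+)=\lim_{\alpha\to0^+}\gamma((V,\alpha),0^+)$ (which exists since $\alpha\mapsto\gamma((V,\alpha),0^+)$ is decreasing). Finally $\Sigma=\{V\in\mathcal{S}:\gamma((V,0^+),0^+)>0\}$. *)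

theory Defs
  imports "HOL-Analysis.Analysis"
begin

definition C2_on :: "'a::euclidean_space set \<Rightarrow> ('a \<Rightarrow> real) \<Rightarrow> bool" where
  "C2_on U f \<longleftrightarrow>
     (\<exists>(f' :: 'a \<Rightarrow> 'a \<Rightarrow>\<^sub>L real) (f'' :: 'a \<Rightarrow> 'a \<Rightarrow>\<^sub>L ('a \<Rightarrow>\<^sub>L real)).
        (\<forall>x\<in>U. (f has_derivative blinfun_apply (f' x)) (at x)) \<and>
        (\<forall>x\<in>U. (f' has_derivative blinfun_apply (f'' x)) (at x)) \<and>
        continuous_on U f'')"

text \<open>Being \<open>C\<^sup>2\<close> on the sphere is being the restriction of a \<open>C\<^sup>2\<close> function on an open
  neighbourhood. A function on the sphere is represented by a total function on the whole space,
  whose values away from the sphere are never used.\<close>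

definition C2_sphere :: "('a::euclidean_space \<Rightarrow> real) \<Rightarrow> bool" where
  "C2_sphere V \<longleftrightarrow>
     (\<exists>U f. open U \<and> sphere 0 1 \<subseteq> U \<and> C2_on U f \<and> (\<forall>s\<in>sphere 0 1. f s = V s))"

definition S_class :: "'a::euclidean_space \<Rightarrow> 'a \<Rightarrow> real \<Rightarrow> ('a \<Rightarrow> real) set" where
  "S_class \<xi>m \<xi>p Vmin =
     {V. C2_sphere V \<and> V \<xi>m = Vmin \<and> V \<xi>p = Vmin \<and> (\<forall>s\<in>sphere 0 1. Vmin \<le> V s) \<and>
         (\<exists>\<delta>>0. \<exists>\<mu>>0. \<forall>\<xi>\<in>{\<xi>m, \<xi>p}. \<forall>s\<in>sphere 0 1.
            norm (s - \<xi>) < \<delta> \<longrightarrow> \<mu> * (norm (s - \<xi>))\<^sup>2 \<le> V s - V \<xi>)}"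

definition alpha_star :: "real \<Rightarrow> real" where
  "alpha_star \<alpha> = (2 - \<alpha>) / 2"

text \<open>For \<open>V\<close> in the class above \<open>V > 0\<close> on the sphere, so no truncation takes place in
  \<^const>\<open>ennreal\<close>.\<close>

definition potential :: "('a::euclidean_space \<Rightarrow> real) \<Rightarrow> real \<Rightarrow> 'a \<Rightarrow> ennreal" where
  "potential V \<alpha> x = (if x = 0 then \<infinity> else ennreal (V (x /\<^sub>R norm x) / norm x powr \<alpha>))"

definition L2 :: "real \<Rightarrow> real \<Rightarrow> (real \<Rightarrow> 'a::euclidean_space) \<Rightarrow> bool" where
  "L2 a b f \<longleftrightarrow> f \<in> borel_measurable (lebesgue_on {a..b}) \<and>
     integrable (lebesgue_on {a..b}) (\<lambda>t. (norm (f t))\<^sup>2)"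

text \<open>The support of a test function is a closed subset of the bounded interval \<open>(a, b)\<close>,
  hence compact.\<close>

definition test_function :: "real \<Rightarrow> real \<Rightarrow> (real \<Rightarrow> real) \<Rightarrow> bool" where
  "test_function a b \<phi> \<longleftrightarrow>
     \<phi> C1_differentiable_on UNIV \<and> closure {t. \<phi> t \<noteq> 0} \<subseteq> {a<..<b}"

definition weak_derivative ::
    "real \<Rightarrow> real \<Rightarrow> (real \<Rightarrow> 'a::euclidean_space) \<Rightarrow> (real \<Rightarrow> 'a) \<Rightarrow> bool" where
  "weak_derivative a b x v \<longleftrightarrow>
     (\<forall>\<phi>. test_function a b \<phi> \<longrightarrow>
        (LINT t|lebesgue_on {a..b}. deriv \<phi> t *\<^sub>R x t) =
        - (LINT t|lebesgue_on {a..b}. \<phi> t *\<^sub>R v t))"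

text \<open>\<open>x\<close> is the continuous representative of an element of \<open>H\<^sup>1((a,b))\<close>, which gives a meaning to
  its pointwise values, and \<open>v\<close> is its weak derivative (unique up to a null set).\<close>

definition H1_curve ::
    "real \<Rightarrow> real \<Rightarrow> (real \<Rightarrow> 'a::euclidean_space) \<Rightarrow> (real \<Rightarrow> 'a) \<Rightarrow> bool" where
  "H1_curve a b x v \<longleftrightarrow>
     continuous_on {a..b} x \<and> L2 a b x \<and> L2 a b v \<and> weak_derivative a b x v"

definition action ::
    "('a::euclidean_space \<Rightarrow> real) \<Rightarrow> real \<Rightarrow> real \<Rightarrow> real \<Rightarrow> (real \<Rightarrow> 'a) \<Rightarrow> (real \<Rightarrow> 'a) \<Rightarrow> ennreal" where
  "action V \<alpha> a b x v =
     (\<integral>\<^sup>+ t. ennreal (1 / 2 * (norm (v t))\<^sup>2) + potential V \<alpha> (x t) \<partial>lebesgue_on {a..b})"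

definition admissible ::
    "'a::euclidean_space \<Rightarrow> 'a \<Rightarrow> real \<Rightarrow> real \<Rightarrow> (real \<Rightarrow> 'a) \<Rightarrow> (real \<Rightarrow> 'a) \<Rightarrow> bool" where
  "admissible \<xi>m \<xi>p \<epsilon> T x v \<longleftrightarrow>
     0 < T \<and> H1_curve (- T) T x v \<and> x (- T) = \<xi>m \<and> x T = \<xi>p \<and>
     (\<forall>t\<in>{- T..T}. \<epsilon> \<le> norm (x t)) \<and> (\<exists>t\<in>{- T..T}. norm (x t) = \<epsilon>)"

definition m_level ::
    "'a::euclidean_space \<Rightarrow> 'a \<Rightarrow> real \<Rightarrow> ('a \<Rightarrow> real) \<Rightarrow> real \<Rightarrow> real \<Rightarrow> ereal" where
  "m_level \<xi>m \<xi>p Vmin V \<alpha> \<epsilon> =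
     (if \<epsilon> = 0 then ereal (2 / alpha_star \<alpha> * sqrt (2 * Vmin))
      else enn2ereal (Inf {action V \<alpha> (- T) T x v | T x v. admissible \<xi>m \<xi>p \<epsilon> T x v}))"

definition gam ::
    "'a::euclidean_space \<Rightarrow> 'a \<Rightarrow> real \<Rightarrow> ('a \<Rightarrow> real) \<Rightarrow> real \<Rightarrow> real \<Rightarrow> ereal" where
  "gam \<xi>m \<xi>p Vmin V \<alpha> \<epsilon> =
     (m_level \<xi>m \<xi>p Vmin V \<alpha> \<epsilon> - m_level \<xi>m \<xi>p Vmin V \<alpha> 0) / ereal (\<epsilon> powr alpha_star \<alpha>)"

definition gam_eps0 ::
    "'a::euclidean_space \<Rightarrow> 'a \<Rightarrow> real \<Rightarrow> ('a \<Rightarrow> real) \<Rightarrow> real \<Rightarrow> ereal" where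
  "gam_eps0 \<xi>m \<xi>p Vmin V \<alpha> = Lim (at_right 0) (\<lambda>\<epsilon>. gam \<xi>m \<xi>p Vmin V \<alpha> \<epsilon>)"

definition gam_alpha0 ::
    "'a::euclidean_space \<Rightarrow> 'a \<Rightarrow> real \<Rightarrow> ('a \<Rightarrow> real) \<Rightarrow> ereal" where
  "gam_alpha0 \<xi>m \<xi>p Vmin V = Lim (at_right 0) (\<lambda>\<alpha>. gam_eps0 \<xi>m \<xi>p Vmin V \<alpha>)"

definition Sigma_class :: "'a::euclidean_space \<Rightarrow> 'a \<Rightarrow> real \<Rightarrow> ('a \<Rightarrow> real) set" where
  "Sigma_class \<xi>m \<xi>p Vmin = {V \<in> S_class \<xi>m \<xi>p Vmin. 0 < gam_alpha0 \<xi>m \<xi>p Vmin V}"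

end

theory Submission
  imports Defs
begin

text \<open>
  The positivity comes from a lower bound for the action of every competitor, and the work lies in
  showing that the two limits in the definition of \<^const>\<open>gam_alpha0\<close> exist.

  \<^bold>\<open>Lower bound\<close> (\<open>arc_actions_lower_bound\<close>). Let \<open>x\<close> join \<open>\<xi>m\<close> to \<open>\<xi>p\<close> and let \<open>\<epsilon>\<close> be the minimum of \<open>r = |x|\<close>. Its
  direction \<open>x / |x|\<close> leaves \<open>Fm\<close>, travels through \<open>O'\<close> and arrives in \<open>Fp\<close>. The
  radial part of the kinetic energy and the part \<open>Vmin / r powr \<alpha>\<close> of the potential dominate
  \<open>sqrt (2 * Vmin) * r powr (- \<alpha> / 2) * |r'|\<close>, whose integral is at least that of the motion
  from \<open>r = 1\<close> down to \<open>r = \<epsilon>\<close> and back. During the passage through \<open>O'\<close>, the tangential part of the kinetic energy and the excess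
  \<open>W = min (V - Vmin)\<close> over the closure of \<open>O'\<close> dominate \<open>sqrt (2 * W) * \<epsilon> powr alpha_star \<alpha>\<close> times the speed of the
  direction. Together,
  \<open>gam \<xi>m \<xi>p Vmin V \<alpha> \<epsilon> \<ge> sqrt (2 * W) * setdist Fm Fp - (2 / alpha_star \<alpha>) * sqrt (2 * Vmin)\<close>,
  and as \<open>\<alpha>\<close> tends to \<open>0\<close> the right-hand side tends to a positive number by hypothesis.

  \<^bold>\<open>Limit in \<open>\<epsilon>\<close>\<close> (\<open>gam_mono\<close>). Shrinking a competitor by a homothety and joining it to
  the unit sphere by two radial motions of zero energy shows that \<open>gam\<close> increases with \<open>\<epsilon>\<close>.

  \<^bold>\<open>Limit in \<open>\<alpha>\<close>\<close> (\<open>alpha_star_gam_eps0_antimono\<close>). A radial power of the space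
  variable together with a change of time turns a competitor for one exponent into a competitor for
  a larger one. This makes \<open>alpha_star \<alpha> * gam_eps0 \<xi>m \<xi>p Vmin V \<alpha>\<close> decreasing in \<open>\<alpha>\<close>, and the limit of
  \<open>gam_eps0\<close> exists because \<open>alpha_star \<alpha>\<close> tends to \<open>1\<close>.

  \<^bold>\<open>Curves.\<close> All these operations act on \<open>H\<^sup>1\<close> curves given by weak derivatives.
  The lemma \<open>H1_curve_iff_energy_curve\<close> identifies them with primitives of square-integrable
  velocities, for which \<open>primitive_on_chain_rule\<close> provides the calculus and
  \<open>energy_curve_transform\<close> and \<open>energy_curve_join\<close> provide the constructions.
\<close>

section \<open>The chain rule for primitives of integrable functions\<close>

text \<open>Absolute continuity, with the derivative given as integrable data. Every statement about the
  derivative of a curve thus becomes a statement about integrals.\<close>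

definition primitive_on :: "real \<Rightarrow> real \<Rightarrow> (real \<Rightarrow> 'a::euclidean_space) \<Rightarrow> (real \<Rightarrow> 'a) \<Rightarrow> bool" where
  "primitive_on a b x v \<longleftrightarrow> v absolutely_integrable_on {a..b} \<and>
     (\<forall>t\<in>{a..b}. x t = x a + integral {a..t} v)"

lemma primitive_onD:
  assumes "primitive_on a b x v" "t \<in> {a..b}"
  shows "x t = x a + integral {a..t} v"
  using assms unfolding primitive_on_def by blast

lemma primitive_on_increment:
  assumes "primitive_on a b x v" "a \<le> s" "s \<le> t" "t \<le> b"
  shows "x t - x s = integral {s..t} v"
proof -
  have "v integrable_on {a..t}"
    using absolutely_integrable_on_subinterval[of "{a..b}" v a t] assms
    by (auto simp: primitive_on_def absolutely_integrable_on_def)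
  then have "integral {a..s} v + integral {s..t} v = integral {a..t} v"
    using assms by (intro Henstock_Kurzweil_Integration.integral_combine) auto
  from this[symmetric] show ?thesis
    using primitive_onD[OF assms(1), of s] primitive_onD[OF assms(1), of t] assms(2-) by simp
qed

lemma primitive_on_continuous:
  assumes "primitive_on a b x v"
  shows "continuous_on {a..b} x"
proof -
  have "v integrable_on {a..b}"
    using assms by (auto simp: primitive_on_def absolutely_integrable_on_def)
  then have "continuous_on {a..b} (\<lambda>t. x a + integral {a..t} v)"
    by (intro continuous_intros indefinite_integral_continuous_1)
  then show ?thesis
    by (rule continuous_on_eq) (rule primitive_onD[OF assms, symmetric])
qed

text \<open>In coordinates, \<open>D t (v t)\<close> is a finite sum of products of an integrable and a bounded
  continuous function.\<close>

lemma absolutely_integrable_continuous_linear: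
  fixes v :: "real \<Rightarrow> 'a::euclidean_space" and D :: "real \<Rightarrow> 'a \<Rightarrow> 'b::euclidean_space"
  assumes v: "v absolutely_integrable_on {a..b}"
    and lin: "\<And>t. t \<in> {a..b} \<Longrightarrow> linear (D t)"
    and cont: "\<And>h. continuous_on {a..b} (\<lambda>t. D t h)"
  shows "(\<lambda>t. D t (v t)) absolutely_integrable_on {a..b}"
proof -
  have "(\<lambda>t. (v t \<bullet> i) *\<^sub>R D t i) absolutely_integrable_on {a..b}" for i
  proof (rule absolutely_integrable_bounded_measurable_product[of "\<lambda>z r. r *\<^sub>R z"])
    show "bilinear (\<lambda>(z::'b) (r::real). r *\<^sub>R z)"
      by (simp add: bilinear_def linear_iff algebra_simps)
    show "(\<lambda>t. D t i) \<in> borel_measurable (lebesgue_on {a..b})"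
      by (intro continuous_imp_measurable_on_sets_lebesgue cont) auto
    show "bounded ((\<lambda>t. D t i) ` {a..b})"
      by (intro compact_imp_bounded compact_continuous_image cont compact_Icc)
    show "(\<lambda>t. v t \<bullet> i) absolutely_integrable_on {a..b}"
      by (rule absolutely_integrable_component[OF v])
  qed auto
  then have *: "(\<lambda>t. \<Sum>i\<in>Basis. (v t \<bullet> i) *\<^sub>R D t i) absolutely_integrable_on {a..b}"
    by (intro absolutely_integrable_sum) auto
  have "(\<Sum>i\<in>Basis. (v t \<bullet> i) *\<^sub>R D t i) = D t (v t)" if "t \<in> {a..b}" for t
  proof -
    have "D t (v t) = D t (\<Sum>i\<in>Basis. (v t \<bullet> i) *\<^sub>R i)"
      by (simp add: euclidean_representation)
    also have "\<dots> = (\<Sum>i\<in>Basis. (v t \<bullet> i) *\<^sub>R D t i)"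
      using lin[OF that] by (simp add: linear_sum linear_scale)
    finally show ?thesis ..
  qed
  then show ?thesis
    using absolutely_integrable_spike[OF *, of "{}"] by auto
qed

text \<open>The defect \<open>G (x t) - \<integral>\<^sub>a\<^sup>t D v\<close> is constant. Near a point \<open>c\<close>, differentiability of \<open>G\<close> at \<open>x c\<close> and
  continuity of \<open>D\<close> at \<open>c\<close> bound its increments over intervals around \<open>c\<close> by \<open>\<eta>\<close> times those of
  \<open>\<integral> norm v\<close>. The bound is additive over adjacent intervals, so bisection extends it to the whole
  interval, and \<open>\<eta>\<close> is arbitrary.\<close>

lemma primitive_on_chain_rule:
  fixes x v :: "real \<Rightarrow> 'a::euclidean_space" and G :: "'a \<Rightarrow> 'b::euclidean_space"
  assumes prim: "primitive_on a b x v"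
    and deriv: "\<And>t. t \<in> {a..b} \<Longrightarrow> (G has_derivative D t) (at (x t))"
    and cont: "\<And>h. continuous_on {a..b} (\<lambda>t. D t h)"
  shows "primitive_on a b (\<lambda>t. G (x t)) (\<lambda>t. D t (v t))"
proof -
  have vint: "v absolutely_integrable_on {a..b}"
    using prim by (simp add: primitive_on_def)
  have lin: "linear (D t)" if "t \<in> {a..b}" for t
    using deriv[OF that] has_derivative_linear by blast
  have Dv: "(\<lambda>t. D t (v t)) absolutely_integrable_on {a..b}"
    by (rule absolutely_integrable_continuous_linear[OF vint lin cont])
  note sub = absolutely_integrable_on_subinterval
  have est: "norm (G (x t) - G (x s) - integral {s..t} (\<lambda>\<tau>. D \<tau> (v \<tau>))) \<le> \<eta> * integral {s..t} (\<lambda>\<tau>. norm (v \<tau>))"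
    if "a \<le> s" "s \<le> t" "t \<le> b" "0 < \<eta>" for s t \<eta>
  proof -
    have "s \<le> t \<longrightarrow> a \<le> s \<longrightarrow> t \<le> b \<longrightarrow>
       norm (G (x t) - G (x s) - integral {s..t} (\<lambda>\<tau>. D \<tau> (v \<tau>))) \<le> \<eta> * integral {s..t} (\<lambda>\<tau>. norm (v \<tau>))"
      using \<open>s \<le> t\<close>
    proof (induct rule: Bolzano)
      case (trans p q r)
      show ?case
      proof (intro impI)
        assume "p \<le> r" "a \<le> p" "r \<le> b"
        then have i: "(\<lambda>\<tau>. D \<tau> (v \<tau>)) absolutely_integrable_on {p..r}" "v absolutely_integrable_on {p..r}"
          using trans by (auto intro!: sub[OF Dv] sub[OF vint])
        have "integral {p..r} (\<lambda>\<tau>. D \<tau> (v \<tau>)) = integral {p..q} (\<lambda>\<tau>. D \<tau> (v \<tau>)) + integral {q..r} (\<lambda>\<tau>. D \<tau> (v \<tau>))"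
          "integral {p..r} (\<lambda>\<tau>. norm (v \<tau>)) = integral {p..q} (\<lambda>\<tau>. norm (v \<tau>)) + integral {q..r} (\<lambda>\<tau>. norm (v \<tau>))"
          using trans i by (auto simp: absolutely_integrable_on_def Henstock_Kurzweil_Integration.integral_combine)
        then have E: "G (x r) - G (x p) - integral {p..r} (\<lambda>\<tau>. D \<tau> (v \<tau>)) =
           (G (x q) - G (x p) - integral {p..q} (\<lambda>\<tau>. D \<tau> (v \<tau>))) + (G (x r) - G (x q) - integral {q..r} (\<lambda>\<tau>. D \<tau> (v \<tau>)))"
          "\<eta> * integral {p..r} (\<lambda>\<tau>. norm (v \<tau>)) = \<eta> * integral {p..q} (\<lambda>\<tau>. norm (v \<tau>)) + \<eta> * integral {q..r} (\<lambda>\<tau>. norm (v \<tau>))"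
          by (auto simp: algebra_simps)
        show "norm (G (x r) - G (x p) - integral {p..r} (\<lambda>\<tau>. D \<tau> (v \<tau>))) \<le> \<eta> * integral {p..r} (\<lambda>\<tau>. norm (v \<tau>))"
          unfolding E by (rule norm_triangle_mono; rule trans(1,2)[rule_format])
            (use trans(3,4) \<open>a \<le> p\<close> \<open>r \<le> b\<close> in auto)
      qed
    next
      case (local c)
      then have c: "c \<in> {a..b}" using that by auto
      have "\<exists>d>0. \<forall>y. norm (y - x c) < d \<longrightarrow> norm (G y - G (x c) - D c (y - x c)) \<le> \<eta>/2 * norm (y - x c)"
        using deriv[OF c] \<open>0 < \<eta>\<close> unfolding has_derivative_at_alt
        by (elim conjE allE[of _ "\<eta>/2"]) simp
      then obtain d where d: "d > 0" "\<And>y. norm (y - x c) < d \<Longrightarrow> norm (G y - G (x c) - D c (y - x c)) \<le> \<eta>/2 * norm (y - x c)"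
        by blast
      have "\<exists>d1>0. \<forall>t\<in>{a..b}. \<bar>t - c\<bar> < d1 \<longrightarrow> norm (x t - x c) < d"
        using primitive_on_continuous[OF prim] c \<open>d > 0\<close> unfolding continuous_on_iff dist_norm real_norm_def
        by blast
      then obtain d1 where d1: "d1 > 0" "\<And>t. t \<in> {a..b} \<Longrightarrow> \<bar>t - c\<bar> < d1 \<Longrightarrow> norm (x t - x c) < d"
        by blast
      define N where "N = DIM('a)"
      have N: "N > 0" by (simp add: N_def)
      have "\<exists>d>0. \<forall>t\<in>{a..b}. \<bar>t - c\<bar> < d \<longrightarrow> norm (D t i - D c i) < \<eta>/(2*N)" for i
      proof -
        have "\<eta>/(2*N) > 0" using \<open>0 < \<eta>\<close> N by simp
        then show ?thesis
          using cont[of i] c unfolding continuous_on_iff dist_norm real_norm_def by blast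
      qed
      then obtain e where e: "\<And>i. e i > 0" "\<And>i t. t \<in> {a..b} \<Longrightarrow> \<bar>t - c\<bar> < e i \<Longrightarrow> norm (D t i - D c i) < \<eta>/(2*N)"
        by metis
      define d2 where "d2 = min d1 (Min (e ` Basis))"
      have d2: "d2 > 0" using d1 e by (simp add: d2_def)
      have Dest: "norm (D t h - D c h) \<le> \<eta>/2 * norm h" if "t \<in> {a..b}" "\<bar>t - c\<bar> < d2" for t h
      proof -
        have "D t h - D c h = D t (\<Sum>i\<in>Basis. (h \<bullet> i) *\<^sub>R i) - D c (\<Sum>i\<in>Basis. (h \<bullet> i) *\<^sub>R i)"
          by (simp add: euclidean_representation)
        also have "\<dots> = (\<Sum>i\<in>Basis. (h \<bullet> i) *\<^sub>R (D t i - D c i))"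
          using lin[OF that(1)] lin[OF c] by (simp add: linear_sum linear_scale sum_subtractf scaleR_diff_right)
        also have "norm \<dots> \<le> (\<Sum>i\<in>(Basis::'a set). norm h * (\<eta>/(2*N)))"
        proof (rule sum_norm_le)
          fix i :: 'a assume i: "i \<in> Basis"
          have "\<bar>t - c\<bar> < e i" using that(2) i by (auto simp: d2_def)
          then have "norm (D t i - D c i) \<le> \<eta>/(2*N)" using e(2)[OF that(1)] by (simp add: less_imp_le)
          then show "norm ((h \<bullet> i) *\<^sub>R (D t i - D c i)) \<le> norm h * (\<eta>/(2*N))"
            using Basis_le_norm[OF i, of h] unfolding norm_scaleR by (intro mult_mono) auto
        qed
        also have "\<dots> = \<eta>/2 * norm h" using N by (simp add: N_def)
        finally show ?thesis .
      qed
      \<comment> \<open>The estimate on a short interval with the point \<open>c\<close> as one of its ends.\<close>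
      have loc: "norm (G (x q) - G (x p) - integral {p..q} (\<lambda>\<tau>. D \<tau> (v \<tau>))) \<le> \<eta> * integral {p..q} (\<lambda>\<tau>. norm (v \<tau>))"
        if pq: "a \<le> p" "p \<le> q" "q \<le> b" "q - p < d2" "c = p \<or> c = q" for p q
      proof -
        have i: "(\<lambda>\<tau>. D \<tau> (v \<tau>)) absolutely_integrable_on {p..q}" "v absolutely_integrable_on {p..q}"
          using pq by (auto intro!: sub[OF Dv] sub[OF vint])
        define K where "K = integral {p..q} (\<lambda>\<tau>. norm (v \<tau>))"
        have dx: "x q - x p = integral {p..q} v"
          using primitive_on_increment[OF prim] pq by auto
        then have dxK: "norm (x q - x p) \<le> K"
          using i unfolding K_def by (simp add: absolutely_integrable_on_def integral_norm_bound_integral)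
        have near: "norm (x q - x p) < d"
          using d1(2)[of q] d1(2)[of p] pq by (auto simp: d2_def norm_minus_commute)
        have 1: "norm (G (x q) - G (x p) - D c (x q - x p)) \<le> \<eta>/2 * norm (x q - x p)"
        proof (cases "c = p")
          case True then show ?thesis using d(2)[of "x q"] near by simp
        next
          case False
          then have "c = q" using pq by simp
          then have "norm (G (x p) - G (x q) - D c (x p - x q)) \<le> \<eta>/2 * norm (x p - x q)"
            using d(2)[of "x p"] near by (simp add: norm_minus_commute)
          moreover have "D c (x p - x q) = - D c (x q - x p)"
            using linear_neg[OF lin[OF c], of "x q - x p"] by simp
          then have "G (x p) - G (x q) - D c (x p - x q) = - (G (x q) - G (x p) - D c (x q - x p))"
            by simp
          ultimately show ?thesis by (metis norm_minus_cancel norm_minus_commute)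
        qed
        have Dc: "((\<lambda>\<tau>. D c (v \<tau>)) has_integral D c (integral {p..q} v)) {p..q}"
          using has_integral_linear[OF integrable_integral, of v "{p..q}" "D c"] i(2) deriv[OF c]
          by (auto simp: o_def absolutely_integrable_on_def has_derivative_bounded_linear)
        have "D c (x q - x p) - integral {p..q} (\<lambda>\<tau>. D \<tau> (v \<tau>)) = integral {p..q} (\<lambda>\<tau>. D c (v \<tau>) - D \<tau> (v \<tau>))"
          using Dc i(1) unfolding dx
          by (subst Henstock_Kurzweil_Integration.integral_diff) (auto simp: absolutely_integrable_on_def has_integral_iff)
        also have "norm \<dots> \<le> integral {p..q} (\<lambda>\<tau>. \<eta>/2 * norm (v \<tau>))"
        proof (rule integral_norm_bound_integral)
          show "(\<lambda>\<tau>. D c (v \<tau>) - D \<tau> (v \<tau>)) integrable_on {p..q}"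
            using Dc i(1) by (auto simp: absolutely_integrable_on_def has_integral_iff intro!: Henstock_Kurzweil_Integration.integrable_diff)
          show "(\<lambda>\<tau>. \<eta>/2 * norm (v \<tau>)) integrable_on {p..q}"
            using i(2) unfolding absolutely_integrable_on_def by (intro integrable_on_mult_right) blast
          show "norm (D c (v \<tau>) - D \<tau> (v \<tau>)) \<le> \<eta>/2 * norm (v \<tau>)" if "\<tau> \<in> {p..q}" for \<tau>
            using Dest[of \<tau> "v \<tau>"] that pq by (auto simp: norm_minus_commute)
        qed
        also have "\<dots> = \<eta>/2 * K" by (simp add: K_def)
        finally have 2: "norm (D c (x q - x p) - integral {p..q} (\<lambda>\<tau>. D \<tau> (v \<tau>))) \<le> \<eta>/2 * K" .
        have "norm (G (x q) - G (x p) - integral {p..q} (\<lambda>\<tau>. D \<tau> (v \<tau>))) \<le> \<eta>/2 * norm (x q - x p) + \<eta>/2 * K"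
          using norm_triangle_mono[OF 1 2] by simp
        also have "\<dots> \<le> \<eta> * K" using dxK \<open>0 < \<eta>\<close> by (simp add: field_simps)
        finally show ?thesis by (simp add: K_def)
      qed
      show ?case
      proof (intro exI[of _ d2] conjI d2 allI impI)
        fix p q assume pq: "p \<le> c \<and> c \<le> q \<and> q - p < d2" "p \<le> q" "a \<le> p" "q \<le> b"
        have i: "(\<lambda>\<tau>. D \<tau> (v \<tau>)) absolutely_integrable_on {p..q}" "v absolutely_integrable_on {p..q}"
          using pq by (auto intro!: sub[OF Dv] sub[OF vint])
        have "integral {p..q} (\<lambda>\<tau>. D \<tau> (v \<tau>)) = integral {p..c} (\<lambda>\<tau>. D \<tau> (v \<tau>)) + integral {c..q} (\<lambda>\<tau>. D \<tau> (v \<tau>))"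
          "integral {p..q} (\<lambda>\<tau>. norm (v \<tau>)) = integral {p..c} (\<lambda>\<tau>. norm (v \<tau>)) + integral {c..q} (\<lambda>\<tau>. norm (v \<tau>))"
          using pq i by (auto simp: absolutely_integrable_on_def Henstock_Kurzweil_Integration.integral_combine)
        then have E: "G (x q) - G (x p) - integral {p..q} (\<lambda>\<tau>. D \<tau> (v \<tau>)) =
           (G (x c) - G (x p) - integral {p..c} (\<lambda>\<tau>. D \<tau> (v \<tau>))) + (G (x q) - G (x c) - integral {c..q} (\<lambda>\<tau>. D \<tau> (v \<tau>)))"
          "\<eta> * integral {p..q} (\<lambda>\<tau>. norm (v \<tau>)) = \<eta> * integral {p..c} (\<lambda>\<tau>. norm (v \<tau>)) + \<eta> * integral {c..q} (\<lambda>\<tau>. norm (v \<tau>))"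
          by (auto simp: algebra_simps)
        show "norm (G (x q) - G (x p) - integral {p..q} (\<lambda>\<tau>. D \<tau> (v \<tau>))) \<le> \<eta> * integral {p..q} (\<lambda>\<tau>. norm (v \<tau>))"
          unfolding E by (rule norm_triangle_mono; rule loc) (use pq in auto)
      qed
    qed
    then show ?thesis using that by simp
  qed
  have "G (x t) = G (x a) + integral {a..t} (\<lambda>\<tau>. D \<tau> (v \<tau>))" if "t \<in> {a..b}" for t
  proof -
    define K where "K = integral {a..t} (\<lambda>\<tau>. norm (v \<tau>))"
    have K: "K \<ge> 0" unfolding K_def by (intro integral_nonneg) (use sub[OF vint, of a t] that in \<open>auto simp: absolutely_integrable_on_def\<close>)
    have "norm (G (x t) - G (x a) - integral {a..t} (\<lambda>\<tau>. D \<tau> (v \<tau>))) \<le> 0 + \<eta>" if "\<eta> > 0" for \<eta>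
    proof -
      have "norm (G (x t) - G (x a) - integral {a..t} (\<lambda>\<tau>. D \<tau> (v \<tau>))) \<le> \<eta>/(K+1) * K"
        using est[of a t "\<eta>/(K+1)"] \<open>t \<in> {a..b}\<close> \<open>\<eta> > 0\<close> K by (auto simp: K_def)
      also have "\<dots> \<le> \<eta>" using K \<open>\<eta> > 0\<close> by (simp add: field_simps)
      finally show ?thesis by simp
    qed
    then have "norm (G (x t) - G (x a) - integral {a..t} (\<lambda>\<tau>. D \<tau> (v \<tau>))) \<le> 0"
      by (rule field_le_epsilon)
    then show ?thesis by (simp add: algebra_simps)
  qed
  then show ?thesis using Dv unfolding primitive_on_def by blast
qed

section \<open>Sobolev curves as primitives of square-integrable velocities\<close>

lemma primitive_on_indefinite_integral:
  assumes "v absolutely_integrable_on {a..b}"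
  shows "primitive_on a b (\<lambda>t. integral {a..t} v) v"
  using assms by (simp add: primitive_on_def)

text \<open>Integration by parts is the chain rule for \<open>(s, y) \<mapsto> \<phi> s *\<^sub>R y\<close> along the graph of \<open>x\<close>.\<close>

lemma integral_by_parts_primitive_on:
  fixes x v :: "real \<Rightarrow> 'a::euclidean_space"
  assumes prim: "primitive_on a b x v" and "a \<le> b"
    and \<phi>: "\<And>t. (\<phi> has_real_derivative \<phi>' t) (at t)" and cont: "continuous_on UNIV \<phi>'"
  shows "integral {a..b} (\<lambda>t. \<phi>' t *\<^sub>R x t) + integral {a..b} (\<lambda>t. \<phi> t *\<^sub>R v t) = \<phi> b *\<^sub>R x b - \<phi> a *\<^sub>R x a"
    and "(\<lambda>t. \<phi>' t *\<^sub>R x t) absolutely_integrable_on {a..b}"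
    and "(\<lambda>t. \<phi> t *\<^sub>R v t) absolutely_integrable_on {a..b}"
proof -
  have v: "v absolutely_integrable_on {a..b}" using prim by (simp add: primitive_on_def)
  have x: "continuous_on {a..b} x" by (rule primitive_on_continuous[OF prim])
  have c': "continuous_on {a..b} \<phi>'" using cont continuous_on_subset by blast
  have c: "continuous_on {a..b} \<phi>"
    using \<phi> by (meson DERIV_continuous_on has_field_derivative_at_within)
  show I1: "(\<lambda>t. \<phi>' t *\<^sub>R x t) absolutely_integrable_on {a..b}"
    by (intro absolutely_integrable_continuous_real continuous_intros c' x)
  show I2: "(\<lambda>t. \<phi> t *\<^sub>R v t) absolutely_integrable_on {a..b}"
    by (rule absolutely_integrable_continuous_linear[OF v])
      (auto intro!: continuous_intros c simp: linear_iff algebra_simps)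
  have P: "primitive_on a b (\<lambda>t. (t, x t)) (\<lambda>t. (1::real, v t))"
    unfolding primitive_on_def
  proof
    have l0: "(\<lambda>t. (0::real, v t)) absolutely_integrable_on {a..b}"
      using absolutely_integrable_linear[OF v, of "\<lambda>y. (0::real, y)"]
      by (simp add: o_def bounded_linear_Pair bounded_linear_zero bounded_linear_ident)
    then have "(\<lambda>t. (1::real, 0::'a) + (0, v t)) absolutely_integrable_on {a..b}"
      by (intro set_integral_add absolutely_integrable_on_const) auto
    then show A: "(\<lambda>t. (1::real, v t)) absolutely_integrable_on {a..b}" by simp
    show "\<forall>t\<in>{a..b}. (t, x t) = (a, x a) + integral {a..t} (\<lambda>t. (1, v t))"
    proof
      fix t assume t: "t \<in> {a..b}"
      have i: "(\<lambda>t. (1::real, v t)) integrable_on {a..t}"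
        using absolutely_integrable_on_subinterval[OF A, of a t] t by (auto simp: absolutely_integrable_on_def)
      have "fst (integral {a..t} (\<lambda>t. (1::real, v t))) = integral {a..t} (\<lambda>t. 1)"
        using integral_linear[OF i bounded_linear_fst] by (simp add: o_def)
      moreover have "snd (integral {a..t} (\<lambda>t. (1::real, v t))) = integral {a..t} v"
        using integral_linear[OF i bounded_linear_snd] by (simp add: o_def)
      ultimately show "(t, x t) = (a, x a) + integral {a..t} (\<lambda>t. (1, v t))"
        using primitive_onD[OF prim t] t by (simp add: prod_eq_iff)
    qed
  qed
  have "primitive_on a b (\<lambda>t. (\<lambda>p. \<phi> (fst p) *\<^sub>R snd p) (t, x t))
      (\<lambda>t. (\<lambda>h. \<phi> t *\<^sub>R snd h + (fst h * \<phi>' t) *\<^sub>R x t) (1, v t))"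
  proof (rule primitive_on_chain_rule[OF P])
    show "((\<lambda>p. \<phi> (fst p) *\<^sub>R snd p) has_derivative (\<lambda>h. \<phi> t *\<^sub>R snd h + (fst h * \<phi>' t) *\<^sub>R x t)) (at (t, x t))" for t
      using has_derivative_scaleR[OF DERIV_compose_FDERIV[where f=\<phi> and g=fst and x="(t, x t)" and f'="\<phi>' t" and g'=fst and s=UNIV]
          has_derivative_snd[OF has_derivative_ident, of "at (t, x t)"]] \<phi>[of t]
      by (simp add: has_derivative_fst[OF has_derivative_ident])
    show "continuous_on {a..b} (\<lambda>t. \<phi> t *\<^sub>R snd h + (fst h * \<phi>' t) *\<^sub>R x t)" for h :: "real \<times> 'a"
      by (intro continuous_intros c c' x)
  qed
  then have Q: "primitive_on a b (\<lambda>t. \<phi> t *\<^sub>R x t) (\<lambda>t. \<phi> t *\<^sub>R v t + \<phi>' t *\<^sub>R x t)"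
    by simp
  have "integral {a..b} (\<lambda>t. \<phi> t *\<^sub>R v t + \<phi>' t *\<^sub>R x t) = integral {a..b} (\<lambda>t. \<phi> t *\<^sub>R v t) + integral {a..b} (\<lambda>t. \<phi>' t *\<^sub>R x t)"
    using I1 I2 by (intro Henstock_Kurzweil_Integration.integral_add) (auto simp: absolutely_integrable_on_def)
  then show "integral {a..b} (\<lambda>t. \<phi>' t *\<^sub>R x t) + integral {a..b} (\<lambda>t. \<phi> t *\<^sub>R v t) = \<phi> b *\<^sub>R x b - \<phi> a *\<^sub>R x a"
    using primitive_onD[OF Q, of b] \<open>a \<le> b\<close> by (simp add: algebra_simps)
qed

lemma integral_by_parts_test_function:
  fixes x v :: "real \<Rightarrow> 'a::euclidean_space"
  assumes prim: "primitive_on a b x v" and "a \<le> b" and \<phi>: "test_function a b \<phi>"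
  shows "integral {a..b} (\<lambda>t. deriv \<phi> t *\<^sub>R x t) = - integral {a..b} (\<lambda>t. \<phi> t *\<^sub>R v t)"
    and "(\<lambda>t. deriv \<phi> t *\<^sub>R x t) absolutely_integrable_on {a..b}"
    and "(\<lambda>t. \<phi> t *\<^sub>R v t) absolutely_integrable_on {a..b}"
proof -
  obtain D where D: "\<And>t. (\<phi> has_vector_derivative D t) (at t)" "continuous_on UNIV D"
    using \<phi> unfolding test_function_def C1_differentiable_on_def by auto
  have Dd: "deriv \<phi> = D"
    using D(1) by (auto simp: has_real_derivative_iff_has_vector_derivative intro!: DERIV_imp_deriv)
  have "\<phi> a = 0" "\<phi> b = 0"
    using \<phi> closure_subset[of "{t. \<phi> t \<noteq> 0}"] unfolding test_function_def by auto
  then show "integral {a..b} (\<lambda>t. deriv \<phi> t *\<^sub>R x t) = - integral {a..b} (\<lambda>t. \<phi> t *\<^sub>R v t)"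
    and "(\<lambda>t. deriv \<phi> t *\<^sub>R x t) absolutely_integrable_on {a..b}"
    and "(\<lambda>t. \<phi> t *\<^sub>R v t) absolutely_integrable_on {a..b}"
    using integral_by_parts_primitive_on[OF prim \<open>a \<le> b\<close>, of \<phi> D] D
    by (auto simp: Dd has_real_derivative_iff_has_vector_derivative eq_neg_iff_add_eq_0)
qed

lemma DERIV_positive_part_square:
  "((\<lambda>u::real. (max 0 u)\<^sup>2 / 2) has_real_derivative max 0 u) (at u)"
proof -
  consider "u < 0" | "u > 0" | "u = 0" by linarith
  then show ?thesis
  proof cases
    case 1
    have "((\<lambda>u::real. 0) has_real_derivative 0) (at u)" by simp
    then have "((\<lambda>u::real. (max 0 u)\<^sup>2 / 2) has_real_derivative 0) (at u)"
      by (rule has_field_derivative_transform_within_open[where S="{..<0}"]) (use 1 in auto)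
    then show ?thesis using 1 by simp
  next
    case 2
    have "((\<lambda>u::real. u\<^sup>2 / 2) has_real_derivative u) (at u)" by (auto intro!: derivative_eq_intros)
    then have "((\<lambda>u::real. (max 0 u)\<^sup>2 / 2) has_real_derivative u) (at u)"
      by (rule has_field_derivative_transform_within_open[where S="{0<..}"]) (use 2 in auto)
    then show ?thesis using 2 by simp
  next
    case 3
    have "((\<lambda>h::real. (max 0 h)\<^sup>2 / 2 / h) \<longlongrightarrow> 0) (at 0)"
    proof (rule Lim_null_comparison)
      show "\<forall>\<^sub>F h in at (0::real). norm ((max 0 h)\<^sup>2 / 2 / h) \<le> \<bar>h\<bar>"
        by (rule always_eventually) (auto simp: max_def power2_eq_square)
      show "((\<lambda>h::real. \<bar>h\<bar>) \<longlongrightarrow> 0) (at 0)" by (intro tendsto_eq_intros) auto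
    qed
    then show ?thesis using 3 by (simp add: DERIV_def)
  qed
qed

text \<open>The tent of height \<open>h\<close> on \<open>[-h, h]\<close>, as a second difference of positive parts. In this form
  its primitive is explicit and is visibly \<open>C\<^sup>1\<close>.\<close>

definition tent :: "real \<Rightarrow> real \<Rightarrow> real" where
  "tent h s = max 0 (s + h) - 2 * max 0 s + max 0 (s - h)"

definition tent_primitive :: "real \<Rightarrow> real \<Rightarrow> real" where
  "tent_primitive h s = (max 0 (s + h))\<^sup>2 / 2 - 2 * ((max 0 s)\<^sup>2 / 2) + (max 0 (s - h))\<^sup>2 / 2"

lemma DERIV_tent_primitive: "(tent_primitive h has_real_derivative tent h s) (at s)"
  unfolding tent_primitive_def[abs_def] tent_def
  using DERIV_shift[THEN iffD1, OF DERIV_positive_part_square[of "s + h"]]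
    DERIV_shift[THEN iffD1, OF DERIV_positive_part_square[of "s + - h"]]
  by (intro DERIV_add DERIV_diff DERIV_cmult DERIV_positive_part_square) simp_all

lemma DERIV_tent_primitive_shift:
  "((\<lambda>s. tent_primitive h (s - p)) has_real_derivative tent h (s - p)) (at s within S)"
  using DERIV_shift[THEN iffD1, OF DERIV_tent_primitive[of h "s + - p"]]
  by (simp add: has_field_derivative_at_within)

lemma tent_nonneg: "0 \<le> tent h s" if "0 < h"
  using that by (auto simp: tent_def max_def)

lemma tent_eq_0: "tent h s = 0" if "0 < h" "h \<le> \<bar>s\<bar>"
  using that by (auto simp: tent_def max_def)

lemma tent_primitive_left: "tent_primitive h s = 0" if "0 < h" "s \<le> - h"
  using that by (auto simp: tent_primitive_def max_def)

lemma tent_primitive_right: "tent_primitive h s = h\<^sup>2" if "0 < h" "h \<le> s"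
  using that by (auto simp: tent_primitive_def max_def field_simps power2_eq_square)

lemma continuous_on_tent: "continuous_on S (tent h)"
  unfolding tent_def[abs_def] by (intro continuous_intros)

lemma tent_average_close:
  fixes z :: "real \<Rightarrow> 'a::euclidean_space"
  assumes z: "continuous_on {a..b} z" and h: "0 < h" "a \<le> p - h" "p + h \<le> b"
    and close: "\<And>s. \<bar>s - p\<bar> \<le> h \<Longrightarrow> norm (z s - z p) \<le> \<eta>"
  shows "norm (integral {a..b} (\<lambda>s. tent h (s - p) *\<^sub>R z s) - h\<^sup>2 *\<^sub>R z p) \<le> h\<^sup>2 * \<eta>"
proof -
  have ct: "continuous_on {a..b} (\<lambda>s. tent h (s - p))"
    by (intro continuous_on_compose2[OF continuous_on_tent[of UNIV]] continuous_intros) auto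
  have "((\<lambda>s. tent h (s - p)) has_integral tent_primitive h (b - p) - tent_primitive h (a - p)) {a..b}"
    using h by (intro fundamental_theorem_of_calculus)
      (auto intro!: DERIV_tent_primitive_shift simp flip: has_real_derivative_iff_has_vector_derivative)
  then have T: "((\<lambda>s. tent h (s - p)) has_integral h\<^sup>2) {a..b}"
    using h by (simp add: tent_primitive_left tent_primitive_right)
  have "((\<lambda>s. tent h (s - p) *\<^sub>R z p) has_integral h\<^sup>2 *\<^sub>R z p) {a..b}"
    by (rule has_integral_scaleR_left[OF T])
  moreover have "(\<lambda>s. tent h (s - p) *\<^sub>R z s) integrable_on {a..b}"
    by (intro integrable_continuous_real continuous_intros ct z)
  ultimately have "integral {a..b} (\<lambda>s. tent h (s - p) *\<^sub>R z s) - h\<^sup>2 *\<^sub>R z p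
      = integral {a..b} (\<lambda>s. tent h (s - p) *\<^sub>R z s - tent h (s - p) *\<^sub>R z p)"
    by (subst Henstock_Kurzweil_Integration.integral_diff) (auto simp: has_integral_iff)
  also have "norm \<dots> \<le> integral {a..b} (\<lambda>s. tent h (s - p) * \<eta>)"
  proof (rule integral_norm_bound_integral)
    show "(\<lambda>s. tent h (s - p) *\<^sub>R z s - tent h (s - p) *\<^sub>R z p) integrable_on {a..b}"
      by (intro integrable_continuous_real continuous_intros ct z)
    show "(\<lambda>s. tent h (s - p) * \<eta>) integrable_on {a..b}"
      by (intro integrable_continuous_real continuous_intros ct)
    fix s
    show "norm (tent h (s - p) *\<^sub>R z s - tent h (s - p) *\<^sub>R z p) \<le> tent h (s - p) * \<eta>"
    proof (cases "\<bar>s - p\<bar> \<le> h")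
      case True
      then show ?thesis
        using close[of s] tent_nonneg[of h "s - p"] h
        by (simp flip: scaleR_diff_right add: mult_left_mono)
    next
      case False
      then show ?thesis using tent_eq_0[of h "s - p"] h by simp
    qed
  qed
  also have "\<dots> = h\<^sup>2 * \<eta>"
    using has_integral_mult_left[OF T, of \<eta>] by (simp add: has_integral_iff)
  finally show ?thesis .
qed

text \<open>For two interior points \<open>p\<close> and \<open>q\<close>, the difference of a tent at \<open>p\<close> and a tent at \<open>q\<close> is the derivative of a
  test function, because the two tents have the same mass. So the weighted means of \<open>z\<close> near \<open>p\<close> and near
  \<open>q\<close> agree, and they approach \<open>z p\<close> and \<open>z q\<close> as the tents shrink.\<close>

lemma du_Bois_Reymond:
  fixes z :: "real \<Rightarrow> 'a::euclidean_space"
  assumes z: "continuous_on {a..b} z" and "a < b"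
    and zero: "\<And>\<phi>. test_function a b \<phi> \<Longrightarrow> integral {a..b} (\<lambda>t. deriv \<phi> t *\<^sub>R z t) = 0"
    and t: "t \<in> {a..b}"
  shows "z t = z a"
proof -
  have eq: "z p = z q" if "a < p" "p < b" "a < q" "q < b" for p q
  proof -
    have "norm (z p - z q) \<le> 0 + \<eta>" if "\<eta> > 0" for \<eta>
    proof -
      have near: "\<exists>d>0. \<forall>s\<in>{a..b}. \<bar>s - c\<bar> < d \<longrightarrow> norm (z s - z c) < \<eta>/2" if "c \<in> {a..b}" for c
        using z that half_gt_zero[OF \<open>\<eta> > 0\<close>] unfolding continuous_on_iff dist_norm real_norm_def by blast
      obtain d1 where d1: "d1 > 0" "\<And>s. s\<in>{a..b} \<Longrightarrow> \<bar>s - p\<bar> < d1 \<Longrightarrow> norm (z s - z p) < \<eta>/2"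
        using near[of p] \<open>a < p\<close> \<open>p < b\<close> by auto
      obtain d2 where d2: "d2 > 0" "\<And>s. s\<in>{a..b} \<Longrightarrow> \<bar>s - q\<bar> < d2 \<Longrightarrow> norm (z s - z q) < \<eta>/2"
        using near[of q] \<open>a < q\<close> \<open>q < b\<close> by auto
      define m where "m = Min {d1, d2, p - a, b - p, q - a, b - q}"
      have "m > 0" using d1 d2 that \<open>a < p\<close> \<open>p < b\<close> \<open>a < q\<close> \<open>q < b\<close> by (simp add: m_def)
      moreover have "m \<le> d1" "m \<le> d2" "m \<le> p - a" "m \<le> b - p" "m \<le> q - a" "m \<le> b - q"
        by (auto simp: m_def)
      moreover define h where "h = m / 2"
      ultimately have h: "0 < h" "h < d1" "h < d2" "a < p - h" "p + h < b" "a < q - h" "q + h < b"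
        by auto
      define \<phi> where "\<phi> s = tent_primitive h (s - p) - tent_primitive h (s - q)" for s
      have \<phi>': "(\<phi> has_real_derivative tent h (s - p) - tent h (s - q)) (at s)" for s
        unfolding \<phi>_def[abs_def]
        by (intro DERIV_diff DERIV_tent_primitive_shift)
      have ct: "continuous_on S (\<lambda>s. tent h (s - c))" for c S
        by (intro continuous_on_compose2[OF continuous_on_tent[of UNIV]] continuous_intros) auto
      have supp: "{s. \<phi> s \<noteq> 0} \<subseteq> {min p q - h..max p q + h}"
      proof
        fix s assume "s \<in> {s. \<phi> s \<noteq> 0}"
        then show "s \<in> {min p q - h..max p q + h}"
          using h tent_primitive_left[of h "s - p"] tent_primitive_left[of h "s - q"]
            tent_primitive_right[of h "s - p"] tent_primitive_right[of h "s - q"]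
          by (cases "s < min p q - h"; cases "s > max p q + h") (auto simp: \<phi>_def)
      qed
      have "test_function a b \<phi>"
        unfolding test_function_def C1_differentiable_on_def
      proof (intro conjI exI ballI)
        show "(\<phi> has_vector_derivative tent h (s - p) - tent h (s - q)) (at s)" for s
          using \<phi>' by (simp add: has_real_derivative_iff_has_vector_derivative)
        show "continuous_on UNIV (\<lambda>s. tent h (s - p) - tent h (s - q))"
          by (intro continuous_intros ct)
        show "closure {t. \<phi> t \<noteq> 0} \<subseteq> {a<..<b}"
          using closure_minimal[OF supp] h by (auto simp: min_def max_def split: if_splits)
      qed
      from zero[OF this] have "integral {a..b} (\<lambda>t. (tent h (t - p) - tent h (t - q)) *\<^sub>R z t) = 0"
        by (simp add: DERIV_imp_deriv[OF \<phi>'])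
      also have "integral {a..b} (\<lambda>t. (tent h (t - p) - tent h (t - q)) *\<^sub>R z t)
          = integral {a..b} (\<lambda>t. tent h (t - p) *\<^sub>R z t) - integral {a..b} (\<lambda>t. tent h (t - q) *\<^sub>R z t)"
        unfolding scaleR_diff_left
        by (intro Henstock_Kurzweil_Integration.integral_diff integrable_continuous_real continuous_intros ct z)
      finally have e: "integral {a..b} (\<lambda>t. tent h (t - p) *\<^sub>R z t) = integral {a..b} (\<lambda>t. tent h (t - q) *\<^sub>R z t)"
        by simp
      have c1: "norm (z s - z p) \<le> \<eta>/2" if "\<bar>s - p\<bar> \<le> h" for s
        using that h by (intro less_imp_le d1(2)) auto
      have c2: "norm (z s - z q) \<le> \<eta>/2" if "\<bar>s - q\<bar> \<le> h" for s
        using that h by (intro less_imp_le d2(2)) auto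
      have 1: "norm (integral {a..b} (\<lambda>t. tent h (t - q) *\<^sub>R z t) - h\<^sup>2 *\<^sub>R z p) \<le> h\<^sup>2 * (\<eta>/2)"
        unfolding e[symmetric] using h by (intro tent_average_close z c1) auto
      have 2: "norm (integral {a..b} (\<lambda>t. tent h (t - q) *\<^sub>R z t) - h\<^sup>2 *\<^sub>R z q) \<le> h\<^sup>2 * (\<eta>/2)"
        using h by (intro tent_average_close z c2) auto
      have "h\<^sup>2 * norm (z p - z q) = norm (h\<^sup>2 *\<^sub>R z p - h\<^sup>2 *\<^sub>R z q)"
        by (simp flip: scaleR_diff_right)
      also have "\<dots> \<le> h\<^sup>2 * (\<eta>/2) + h\<^sup>2 * (\<eta>/2)"
        using norm_triangle_mono[OF 2 1[unfolded norm_minus_commute[of _ "h\<^sup>2 *\<^sub>R z p"]]]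
        by (simp add: algebra_simps)
      also have "\<dots> = h\<^sup>2 * \<eta>" by simp
      finally show ?thesis using h by simp
    qed
    then have "norm (z p - z q) \<le> 0" by (rule field_le_epsilon)
    then show ?thesis by simp
  qed
  have "z s = z ((a + b) / 2)" if "s \<in> {a..b}" for s
  proof (rule continuous_constant_on_closure[of "{a<..<b}"])
    show "z r = z ((a + b) / 2)" if "r \<in> {a<..<b}" for r
      by (rule eq) (use that in auto)
  qed (use z \<open>a < b\<close> that in \<open>auto simp: closure_greaterThanLessThan\<close>)
  from this[of t] this[of a] show ?thesis using t \<open>a < b\<close> by simp
qed

definition energy_curve :: "real \<Rightarrow> real \<Rightarrow> (real \<Rightarrow> 'a::euclidean_space) \<Rightarrow> (real \<Rightarrow> 'a) \<Rightarrow> bool" where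
  "energy_curve a b x v \<longleftrightarrow> primitive_on a b x v \<and> (\<lambda>t. (norm (v t))\<^sup>2) integrable_on {a..b}"

lemma energy_curveD:
  assumes "energy_curve a b x v"
  shows "primitive_on a b x v" "v absolutely_integrable_on {a..b}" "(\<lambda>t. (norm (v t))\<^sup>2) integrable_on {a..b}"
    "continuous_on {a..b} x"
  using assms primitive_on_continuous[of a b x v] unfolding energy_curve_def primitive_on_def by blast+

lemma L2_iff:
  fixes v :: "real \<Rightarrow> 'a::euclidean_space"
  shows "L2 a b v \<longleftrightarrow> v absolutely_integrable_on {a..b} \<and> (\<lambda>t. (norm (v t))\<^sup>2) integrable_on {a..b}"
proof
  assume L: "L2 a b v"
  then have m: "v \<in> borel_measurable (lebesgue_on {a..b})" and i: "(\<lambda>t. (norm (v t))\<^sup>2) integrable_on {a..b}"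
    by (auto simp: L2_def integrable_on_lebesgue_on)
  have "(\<lambda>t. 1 + (norm (v t))\<^sup>2) integrable_on {a..b}"
    using i by (intro Henstock_Kurzweil_Integration.integrable_add) auto
  moreover have "y \<le> 1 + y\<^sup>2" for y :: real
    using zero_le_power2[of "y - 1/2"] by (simp add: power2_eq_square algebra_simps)
  ultimately have "v absolutely_integrable_on {a..b}"
    by (intro measurable_bounded_by_integrable_imp_absolutely_integrable[OF m, of "\<lambda>t. 1 + (norm (v t))\<^sup>2"]) auto
  with i show "v absolutely_integrable_on {a..b} \<and> (\<lambda>t. (norm (v t))\<^sup>2) integrable_on {a..b}" by simp
next
  assume R: "v absolutely_integrable_on {a..b} \<and> (\<lambda>t. (norm (v t))\<^sup>2) integrable_on {a..b}"
  then have "(\<lambda>t. (norm (v t))\<^sup>2) absolutely_integrable_on {a..b}"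
    by (intro nonnegative_absolutely_integrable_1) auto
  with R show "L2 a b v"
    by (simp add: L2_def absolutely_integrable_imp_integrable absolutely_integrable_imp_borel_measurable)
qed

lemma LINT_lebesgue_on_eq_integral:
  fixes f :: "real \<Rightarrow> 'a::euclidean_space"
  assumes "f absolutely_integrable_on {a..b}"
  shows "(LINT t|lebesgue_on {a..b}. f t) = integral {a..b} f"
  by (intro lebesgue_integral_eq_integral absolutely_integrable_imp_integrable assms) auto

text \<open>From left to right, \<open>x\<close> and the primitive of \<open>v\<close> have the same weak derivative, so their
  difference is constant by du Bois-Reymond. From right to left this is integration by
  parts against test functions, which vanish at the ends. The equivalence replaces test functions
  by an integral representation that is stable under composition, change of time and concatenation.\<close>

lemma H1_curve_iff_energy_curve:
  fixes x v :: "real \<Rightarrow> 'a::euclidean_space"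
  assumes "a < b"
  shows "H1_curve a b x v \<longleftrightarrow> energy_curve a b x v"
proof
  assume H: "H1_curve a b x v"
  then have x: "continuous_on {a..b} x" and v: "v absolutely_integrable_on {a..b}"
    "(\<lambda>t. (norm (v t))\<^sup>2) integrable_on {a..b}" and w: "weak_derivative a b x v"
    by (auto simp: H1_curve_def L2_iff)
  define X where "X t = integral {a..t} v" for t
  have X: "primitive_on a b X v"
    unfolding X_def[abs_def] by (rule primitive_on_indefinite_integral[OF v(1)])
  have const: "x t - X t = x a - X a" if "t \<in> {a..b}" for t
  proof (rule du_Bois_Reymond[of a b "\<lambda>t. x t - X t"])
    show "continuous_on {a..b} (\<lambda>t. x t - X t)"
      by (intro continuous_intros x primitive_on_continuous[OF X])
    show "integral {a..b} (\<lambda>t. deriv \<phi> t *\<^sub>R (x t - X t)) = 0" if \<phi>: "test_function a b \<phi>" for \<phi>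
    proof -
      note P = integral_by_parts_test_function[OF X less_imp_le[OF assms] \<phi>]
      obtain D where D: "\<And>t. (\<phi> has_vector_derivative D t) (at t)" "continuous_on UNIV D"
        using \<phi> unfolding test_function_def C1_differentiable_on_def by auto
      have "deriv \<phi> = D"
        using D(1) by (auto simp: has_real_derivative_iff_has_vector_derivative intro!: DERIV_imp_deriv)
      then have "continuous_on {a..b} (deriv \<phi>)" using D(2) continuous_on_subset by blast
      then have ix: "(\<lambda>t. deriv \<phi> t *\<^sub>R x t) absolutely_integrable_on {a..b}"
        by (intro absolutely_integrable_continuous_real continuous_intros x)
      have "integral {a..b} (\<lambda>t. deriv \<phi> t *\<^sub>R x t) = - integral {a..b} (\<lambda>t. \<phi> t *\<^sub>R v t)"
        using w[unfolded weak_derivative_def, rule_format, OF \<phi>] LINT_lebesgue_on_eq_integral[OF ix]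
          LINT_lebesgue_on_eq_integral[OF P(3)] by simp
      with P ix show ?thesis
        unfolding scaleR_diff_right
        by (subst Henstock_Kurzweil_Integration.integral_diff) (auto simp: absolutely_integrable_on_def)
    qed
  qed (use assms that in auto)
  have "x t = x a + integral {a..t} v" if "t \<in> {a..b}" for t
    using const[OF that] by (simp add: X_def algebra_simps)
  with v show "energy_curve a b x v"
    unfolding energy_curve_def primitive_on_def by blast
next
  assume E: "energy_curve a b x v"
  note p = energy_curveD(1)[OF E] and v = energy_curveD(2,3)[OF E] and x = energy_curveD(4)[OF E]
  have "weak_derivative a b x v"
    unfolding weak_derivative_def
  proof (intro allI impI)
    fix \<phi> assume \<phi>: "test_function a b \<phi>"
    note P = integral_by_parts_test_function[OF p less_imp_le[OF assms] \<phi>]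
    show "(LINT t|lebesgue_on {a..b}. deriv \<phi> t *\<^sub>R x t) = - (LINT t|lebesgue_on {a..b}. \<phi> t *\<^sub>R v t)"
      using P(1) LINT_lebesgue_on_eq_integral[OF P(2)] LINT_lebesgue_on_eq_integral[OF P(3)] by simp
  qed
  moreover have "L2 a b x"
    unfolding L2_iff by (intro conjI absolutely_integrable_continuous_real integrable_continuous_real continuous_intros x)
  ultimately show "H1_curve a b x v"
    using x v by (simp add: H1_curve_def L2_iff)
qed

section \<open>Reparametrization and concatenation of curves\<close>

lemma energy_curve_square_integrable:
  assumes "energy_curve a b x v"
  shows "(\<lambda>t. (norm (v t))\<^sup>2) absolutely_integrable_on {a..b}"
  by (rule nonnegative_absolutely_integrable_1[OF energy_curveD(3)[OF assms]]) simp

lemma square_integrable_continuous_linear: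
  fixes v :: "real \<Rightarrow> 'a::euclidean_space" and D :: "real \<Rightarrow> 'a \<Rightarrow> 'b::euclidean_space"
  assumes v: "v absolutely_integrable_on {a..b}" and v2: "(\<lambda>t. (norm (v t))\<^sup>2) integrable_on {a..b}"
    and lin: "\<And>t. t \<in> {a..b} \<Longrightarrow> linear (D t)"
    and cont: "\<And>h. continuous_on {a..b} (\<lambda>t. D t h)"
  shows "(\<lambda>t. (norm (D t (v t)))\<^sup>2) absolutely_integrable_on {a..b}"
proof -
  have "\<exists>B. \<forall>t\<in>{a..b}. norm (D t i) \<le> B" for i
    using compact_imp_bounded[OF compact_continuous_image[OF cont[of i] compact_Icc]]
    by (auto simp: bounded_iff)
  then have "\<exists>B. \<forall>i. \<forall>t\<in>{a..b}. norm (D t i) \<le> B i" by (intro choice allI)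
  then obtain B where B: "\<And>i t. t \<in> {a..b} \<Longrightarrow> norm (D t i) \<le> B i" by blast
  define C where "C = (\<Sum>i\<in>(Basis::'a set). B i)"
  have le: "norm (D t h) \<le> C * norm h" if "t \<in> {a..b}" for t h
  proof -
    have "D t h = D t (\<Sum>i\<in>Basis. (h \<bullet> i) *\<^sub>R i)"
      by (simp add: euclidean_representation)
    also have "\<dots> = (\<Sum>i\<in>Basis. (h \<bullet> i) *\<^sub>R D t i)"
      using lin[OF that] by (simp add: linear_sum linear_scale)
    also have "norm \<dots> \<le> (\<Sum>i\<in>(Basis::'a set). norm h * B i)"
    proof (rule sum_norm_le)
      fix i :: 'a assume i: "i \<in> Basis"
      show "norm ((h \<bullet> i) *\<^sub>R D t i) \<le> norm h * B i"
        unfolding norm_scaleR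
        by (rule mult_mono) (use Basis_le_norm[OF i, of h] B[OF that, of i] in auto)
    qed
    finally show ?thesis by (simp add: C_def sum_distrib_left mult.commute)
  qed
  have m: "(\<lambda>t. D t (v t)) \<in> borel_measurable (lebesgue_on {a..b})"
    by (rule absolutely_integrable_imp_borel_measurable[OF absolutely_integrable_continuous_linear[OF v lin cont]]) auto
  show ?thesis
  proof (rule measurable_bounded_by_integrable_imp_absolutely_integrable)
    show "(\<lambda>t. (norm (D t (v t)))\<^sup>2) \<in> borel_measurable (lebesgue_on {a..b})" using m by simp
    show "(\<lambda>t. C\<^sup>2 * (norm (v t))\<^sup>2) integrable_on {a..b}" using v2 by (rule integrable_on_mult_right)
    fix t assume "t \<in> {a..b}"
    then show "norm ((norm (D t (v t)))\<^sup>2) \<le> C\<^sup>2 * (norm (v t))\<^sup>2"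
      using power_mono[OF le[of t "v t"], of 2] by (simp add: power_mult_distrib)
  qed auto
qed

lemma time_change_exists:
  fixes \<theta> :: "real \<Rightarrow> real"
  assumes "a < b" and cont: "continuous_on {a..b} \<theta>" and pos: "\<And>t. t \<in> {a..b} \<Longrightarrow> 0 < \<theta> t"
  obtains \<Theta> where "\<Theta> a = c" "inj_on \<Theta> {a..b}"
    "\<And>t. t \<in> {a..b} \<Longrightarrow> (\<Theta> has_real_derivative \<theta> t) (at t within {a..b})"
    "\<And>t. t \<in> {a..b} \<Longrightarrow> \<Theta> ` {a..t} = {c..\<Theta> t}" "c < \<Theta> b"
proof -
  define \<Theta> where "\<Theta> t = c + integral {a..t} \<theta>" for t
  have \<Theta>a: "\<Theta> a = c" by (simp add: \<Theta>_def)
  have d: "(\<Theta> has_real_derivative \<theta> t) (at t within {a..b})" if "t \<in> {a..b}" for t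
    unfolding \<Theta>_def[abs_def]
    using integral_has_real_derivative[OF cont that] by (auto intro!: derivative_eq_intros)
  have c: "continuous_on {a..b} \<Theta>"
    using d by (rule DERIV_continuous_on)
  have mono: "\<Theta> s < \<Theta> t" if "a \<le> s" "s < t" "t \<le> b" for s t
  proof (rule DERIV_pos_imp_increasing_open[OF that(2)])
    show "\<exists>y. (\<Theta> has_real_derivative y) (at r) \<and> 0 < y" if "s < r" "r < t" for r
      using d[of r] pos[of r] that \<open>a \<le> s\<close> \<open>t \<le> b\<close> at_within_Icc_at[of a r b] by auto
    show "continuous_on {s..t} \<Theta>" using c that by (auto intro: continuous_on_subset)
  qed
  have inj: "inj_on \<Theta> {a..b}"
  proof (rule linorder_inj_onI')
    show "\<Theta> s \<noteq> \<Theta> t" if "s \<in> {a..b}" "t \<in> {a..b}" "s < t" for s t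
      using mono[of s t] that by simp
  qed
  have im: "\<Theta> ` {a..t} = {c..\<Theta> t}" if "t \<in> {a..b}" for t
  proof
    have "\<Theta> s \<le> \<Theta> r" if "a \<le> s" "s \<le> r" "r \<le> b" for s r
      using mono[of s r] that by (cases "s = r") auto
    from this[of a] this[of _ t] show "\<Theta> ` {a..t} \<subseteq> {c..\<Theta> t}"
      using that \<Theta>a by (intro image_subsetI) simp
    show "{c..\<Theta> t} \<subseteq> \<Theta> ` {a..t}"
    proof
      fix s assume "s \<in> {c..\<Theta> t}"
      moreover have "continuous_on {a..t} \<Theta>" using c that by (auto intro: continuous_on_subset)
      ultimately have "\<exists>r\<ge>a. r \<le> t \<and> \<Theta> r = s"
        using that \<Theta>a by (intro IVT') simp_all
      then show "s \<in> \<Theta> ` {a..t}" by auto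
    qed
  qed
  have "c < \<Theta> b" using mono[of a b] \<Theta>a \<open>a < b\<close> by simp
  from that[OF \<Theta>a inj d im this] show ?thesis .
qed

text \<open>Simultaneous change of the space variable by \<open>\<Phi>\<close> and of the time variable with speed \<open>\<theta>\<close>. The
  integral of an arbitrary function \<open>L\<close> of position and velocity is tracked, because translations,
  homotheties, radial powers and zero-energy parametrizations are all instances, and they need
  different choices of \<open>L\<close>.\<close>

lemma energy_curve_transform:
  fixes x v :: "real \<Rightarrow> 'a::euclidean_space" and \<Phi> :: "'a \<Rightarrow> 'b::euclidean_space" and \<theta> :: "real \<Rightarrow> real"
  assumes curve: "energy_curve a b x v" and "a < b"
    and deriv: "\<And>t. t \<in> {a..b} \<Longrightarrow> (\<Phi> has_derivative D t) (at (x t))"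
    and cont: "\<And>h. continuous_on {a..b} (\<lambda>t. D t h)"
    and \<theta>: "continuous_on {a..b} \<theta>" "\<And>t. t \<in> {a..b} \<Longrightarrow> 0 < \<theta> t"
  obtains d y w where "c < d" "energy_curve c d y w" "y c = \<Phi> (x a)" "y d = \<Phi> (x b)"
    "y ` {c..d} = \<Phi> ` x ` {a..b}"
    "\<forall>L :: 'b \<Rightarrow> 'b \<Rightarrow> real. (\<lambda>t. \<theta> t * L (\<Phi> (x t)) (D t (v t) /\<^sub>R \<theta> t)) absolutely_integrable_on {a..b} \<longrightarrow>
       (\<lambda>s. L (y s) (w s)) absolutely_integrable_on {c..d} \<and>
       integral {c..d} (\<lambda>s. L (y s) (w s)) = integral {a..b} (\<lambda>t. \<theta> t * L (\<Phi> (x t)) (D t (v t) /\<^sub>R \<theta> t))"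
proof -
  obtain \<Theta> where \<Theta>: "\<Theta> a = c" "inj_on \<Theta> {a..b}"
    "\<And>t. t \<in> {a..b} \<Longrightarrow> (\<Theta> has_real_derivative \<theta> t) (at t within {a..b})"
    "\<And>t. t \<in> {a..b} \<Longrightarrow> \<Theta> ` {a..t} = {c..\<Theta> t}" "c < \<Theta> b"
    using time_change_exists[OF \<open>a < b\<close> \<theta>] by blast
  define g where "g = inv_into {a..b} \<Theta>"
  have g: "g (\<Theta> t) = t" if "t \<in> {a..b}" for t
    using \<Theta>(2) that by (simp add: g_def)
  define y where "y s = \<Phi> (x (g s))" for s
  define w where "w s = D (g s) (v (g s)) /\<^sub>R \<theta> (g s)" for s
  note v = energy_curveD(2,3)[OF curve] and prim = energy_curveD(1)[OF curve]
  have lin: "linear (D t)" if "t \<in> {a..b}" for t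
    using deriv[OF that] has_derivative_linear by blast
  have im: "\<Theta> ` {a..b} = {c..\<Theta> b}" using \<Theta>(4)[of b] \<open>a < b\<close> by simp
  have L: "(\<lambda>s. L (y s) (w s)) absolutely_integrable_on {c..\<Theta> b} \<and>
       integral {c..\<Theta> b} (\<lambda>s. L (y s) (w s)) = integral {a..b} (\<lambda>t. \<theta> t * L (\<Phi> (x t)) (D t (v t) /\<^sub>R \<theta> t))"
    if i: "(\<lambda>t. \<theta> t * L (\<Phi> (x t)) (D t (v t) /\<^sub>R \<theta> t)) absolutely_integrable_on {a..b}"
    for L :: "'b \<Rightarrow> 'b \<Rightarrow> real"
  proof -
    have e: "\<theta> t * L (\<Phi> (x t)) (D t (v t) /\<^sub>R \<theta> t) = \<bar>\<theta> t\<bar> *\<^sub>R L (y (\<Theta> t)) (w (\<Theta> t))" if "t \<in> {a..b}" for t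
      using \<theta>(2)[OF that] by (simp add: y_def w_def g[OF that])
    have "(\<lambda>t. \<bar>\<theta> t\<bar> *\<^sub>R L (y (\<Theta> t)) (w (\<Theta> t))) absolutely_integrable_on {a..b}"
      by (rule absolutely_integrable_spike[OF i, of "{}"]) (auto simp: e)
    moreover have "integral {a..b} (\<lambda>t. \<bar>\<theta> t\<bar> *\<^sub>R L (y (\<Theta> t)) (w (\<Theta> t))) = integral {a..b} (\<lambda>t. \<theta> t * L (\<Phi> (x t)) (D t (v t) /\<^sub>R \<theta> t))"
      by (rule Henstock_Kurzweil_Integration.integral_cong) (simp add: e)
    ultimately show ?thesis
      using has_absolute_integral_change_of_variables_real[of "{a..b}" \<Theta> \<theta> "\<lambda>s. L (y s) (w s)"] \<Theta>(2,3)
      unfolding im by auto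
  qed
  have Dv: "(\<lambda>t. D t (v t)) absolutely_integrable_on {a..b}"
    by (rule absolutely_integrable_continuous_linear[OF v(1) lin cont])
  have Y: "primitive_on a b (\<lambda>t. \<Phi> (x t)) (\<lambda>t. D t (v t))"
    by (rule primitive_on_chain_rule[OF prim deriv cont])
  have W: "w absolutely_integrable_on {c..\<Theta> t} \<and> integral {c..\<Theta> t} w = integral {a..t} (\<lambda>t. D t (v t))"
    if t: "t \<in> {a..b}" for t
  proof -
    have e: "D r (v r) = \<bar>\<theta> r\<bar> *\<^sub>R w (\<Theta> r)" if "r \<in> {a..t}" for r
    proof -
      have "r \<in> {a..b}" using that t by auto
      then show ?thesis using \<theta>(2)[of r] by (simp add: w_def g)
    qed
    have i: "(\<lambda>r. D r (v r)) absolutely_integrable_on {a..t}"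
      by (rule absolutely_integrable_on_subinterval[of "{a..b}"]) (use Dv t in simp_all)
    have "(\<lambda>r. \<bar>\<theta> r\<bar> *\<^sub>R w (\<Theta> r)) absolutely_integrable_on {a..t}"
      by (rule absolutely_integrable_spike[OF i, of "{}"]) (auto simp: e)
    moreover have "integral {a..t} (\<lambda>r. \<bar>\<theta> r\<bar> *\<^sub>R w (\<Theta> r)) = integral {a..t} (\<lambda>t. D t (v t))"
      by (rule Henstock_Kurzweil_Integration.integral_cong) (simp add: e)
    moreover have "(\<Theta> has_real_derivative \<theta> r) (at r within {a..t})" if "r \<in> {a..t}" for r
      using \<Theta>(3)[of r] that t by (auto intro: DERIV_subset)
    moreover have "inj_on \<Theta> {a..t}" using \<Theta>(2) t by (auto intro: inj_on_subset)
    ultimately show ?thesis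
      using has_absolute_integral_change_of_variables_real[of "{a..t}" \<Theta> \<theta> w] \<Theta>(4)[OF t] by auto
  qed
  have "primitive_on c (\<Theta> b) y w"
    unfolding primitive_on_def
  proof
    show "w absolutely_integrable_on {c..\<Theta> b}" using W[of b] \<open>a < b\<close> by simp
    show "\<forall>s\<in>{c..\<Theta> b}. y s = y c + integral {c..s} w"
    proof
      fix s assume "s \<in> {c..\<Theta> b}"
      then obtain t where t: "t \<in> {a..b}" "s = \<Theta> t" using im by blast
      then show "y s = y c + integral {c..s} w"
        using W[OF t(1)] primitive_onD[OF Y t(1)] \<Theta>(1) g[of a] g[of t] by (auto simp: y_def)
    qed
  qed
  moreover have "(\<lambda>s. (norm (w s))\<^sup>2) integrable_on {c..\<Theta> b}"
  proof -
    have "(\<lambda>t. inverse (\<theta> t) * (norm (D t (v t)))\<^sup>2) absolutely_integrable_on {a..b}"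
      using \<theta> by (intro absolutely_integrable_continuous_linear[where D="\<lambda>t r. inverse (\<theta> t) * r"]
          square_integrable_continuous_linear[OF v lin cont])
        (auto intro!: continuous_intros simp: linear_iff algebra_simps less_imp_neq[symmetric] dest: less_imp_neq)
    then have "(\<lambda>t. \<theta> t * (\<lambda>_ w. (norm w)\<^sup>2) (\<Phi> (x t)) (D t (v t) /\<^sub>R \<theta> t)) absolutely_integrable_on {a..b}"
      by (rule absolutely_integrable_spike[of _ _ "{}"])
        (use \<theta>(2) in \<open>auto simp: field_simps power2_eq_square\<close>)
    \<comment> \<open>The energy is the case \<open>L = (\<lambda>_ w. (norm w)\<^sup>2)\<close> of the change of variables.\<close>
    from L[OF this] show ?thesis by (simp add: absolutely_integrable_on_def)
  qed
  ultimately have curve': "energy_curve c (\<Theta> b) y w" unfolding energy_curve_def by blast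
  have im': "y ` {c..\<Theta> b} = \<Phi> ` x ` {a..b}"
    unfolding im[symmetric] image_image by (rule image_cong) (simp_all add: y_def g)
  show ?thesis
  proof (rule that[of "\<Theta> b" y w])
    show "y c = \<Phi> (x a)" "y (\<Theta> b) = \<Phi> (x b)"
      using g[of a] g[of b] \<Theta>(1) \<open>a < b\<close> by (simp_all add: y_def)
    show "\<forall>L :: 'b \<Rightarrow> 'b \<Rightarrow> real. (\<lambda>t. \<theta> t * L (\<Phi> (x t)) (D t (v t) /\<^sub>R \<theta> t)) absolutely_integrable_on {a..b} \<longrightarrow>
       (\<lambda>s. L (y s) (w s)) absolutely_integrable_on {c..\<Theta> b} \<and>
       integral {c..\<Theta> b} (\<lambda>s. L (y s) (w s)) = integral {a..b} (\<lambda>t. \<theta> t * L (\<Phi> (x t)) (D t (v t) /\<^sub>R \<theta> t))"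
      using L by (intro allI impI)
  qed (rule \<Theta>(5) curve' im')+
qed

lemma absolutely_integrable_cong_except_point:
  fixes f g :: "real \<Rightarrow> 'a::euclidean_space"
  assumes "\<And>t. t \<in> {a..b} \<Longrightarrow> t \<noteq> c \<Longrightarrow> f t = g t" "f absolutely_integrable_on {a..b}"
  shows "g absolutely_integrable_on {a..b}" "integral {a..b} g = integral {a..b} f"
proof -
  have eq: "g t = f t" if "t \<in> {a..b} - {c}" for t using assms(1)[of t] that by simp
  show "g absolutely_integrable_on {a..b}"
    by (rule absolutely_integrable_spike[OF assms(2) negligible_sing eq])
  show "integral {a..b} g = integral {a..b} f"
    by (rule integral_spike[OF negligible_sing[of c]]) (simp add: eq)
qed

lemma absolutely_integrable_join:
  fixes f g :: "real \<Rightarrow> 'a::euclidean_space"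
  assumes "a \<le> b" "b \<le> c" "f absolutely_integrable_on {a..b}" "g absolutely_integrable_on {b..c}"
  shows "(\<lambda>t. if t \<le> b then f t else g t) absolutely_integrable_on {a..c}"
    and "integral {a..c} (\<lambda>t. if t \<le> b then f t else g t) = integral {a..b} f + integral {b..c} g"
proof -
  let ?h = "\<lambda>t. if t \<le> b then f t else g t"
  have 1: "?h absolutely_integrable_on {a..b}" "integral {a..b} ?h = integral {a..b} f"
    using absolutely_integrable_cong_except_point[of a b b f ?h] assms by auto
  have 2: "?h absolutely_integrable_on {b..c}" "integral {b..c} ?h = integral {b..c} g"
    using absolutely_integrable_cong_except_point[of b c b g ?h] assms by auto
  show 3: "?h absolutely_integrable_on {a..c}"
    by (rule absolutely_integrable_on_combine[OF 1(1) 2(1) assms(1,2)])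
  show "integral {a..c} ?h = integral {a..b} f + integral {b..c} g"
    using Henstock_Kurzweil_Integration.integral_combine[OF assms(1,2), of ?h] 1 2 3
    by (simp add: absolutely_integrable_on_def)
qed

lemma energy_curve_join:
  fixes x v y w :: "real \<Rightarrow> 'a::euclidean_space"
  assumes "a \<le> b" "b \<le> c" and x: "energy_curve a b x v" and y: "energy_curve b c y w" and eq: "x b = y b"
  shows "energy_curve a c (\<lambda>t. if t \<le> b then x t else y t) (\<lambda>t. if t \<le> b then v t else w t)"
proof -
  note px = energy_curveD(1)[OF x] and py = energy_curveD(1)[OF y]
  note X = energy_curveD(2)[OF x] energy_curve_square_integrable[OF x]
  note Y = energy_curveD(2)[OF y] energy_curve_square_integrable[OF y]
  let ?u = "\<lambda>t. if t \<le> b then v t else w t"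
  have "primitive_on a c (\<lambda>t. if t \<le> b then x t else y t) ?u"
    unfolding primitive_on_def
  proof (intro conjI ballI)
    show "?u absolutely_integrable_on {a..c}"
      by (rule absolutely_integrable_join[OF assms(1,2) X(1) Y(1)])
    fix t assume t: "t \<in> {a..c}"
    show "(if t \<le> b then x t else y t) = (if a \<le> b then x a else y a) + integral {a..t} ?u"
    proof (cases "t \<le> b")
      case True
      then have "integral {a..t} ?u = integral {a..t} v"
        by (intro Henstock_Kurzweil_Integration.integral_cong) auto
      then show ?thesis using primitive_onD[OF px, of t] t True assms(1) by simp
    next
      case False
      have "w absolutely_integrable_on {b..t}"
        using absolutely_integrable_on_subinterval[OF Y(1), of b t] t by auto
      then have "integral {a..t} ?u = integral {a..b} v + integral {b..t} w"
        using False by (intro absolutely_integrable_join(2) assms(1) X(1)) auto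
      then show ?thesis
        using primitive_onD[OF px, of b] primitive_onD[OF py, of t] t False assms(1) eq by simp
    qed
  qed
  moreover have "(\<lambda>t. (norm (?u t))\<^sup>2) integrable_on {a..c}"
  proof -
    have "(\<lambda>t. if t \<le> b then (norm (v t))\<^sup>2 else (norm (w t))\<^sup>2) integrable_on {a..c}"
      using absolutely_integrable_join(1)[OF assms(1,2) X(2) Y(2)] by (rule set_lebesgue_integral_eq_integral(1))
    moreover have "(\<lambda>t. (norm (?u t))\<^sup>2) = (\<lambda>t. if t \<le> b then (norm (v t))\<^sup>2 else (norm (w t))\<^sup>2)"
      by auto
    ultimately show ?thesis by metis
  qed
  ultimately show ?thesis
    unfolding energy_curve_def by (rule conjI)
qed

section \<open>The action of an arc and the minimal level\<close>

definition lagrangian :: "('a::euclidean_space \<Rightarrow> real) \<Rightarrow> real \<Rightarrow> 'a \<Rightarrow> 'a \<Rightarrow> real" where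
  "lagrangian V \<alpha> y w = 1 / 2 * (norm w)\<^sup>2 + V (y /\<^sub>R norm y) / norm y powr \<alpha>"

text \<open>The time interval is existentially quantified, since the action is invariant under
  translations of time. The trace \<open>C\<close> is recorded because the constraint on \<open>min |x|\<close> depends only
  on it, and traces behave simply under images and concatenation.\<close>

definition arc_action ::
    "('a::euclidean_space \<Rightarrow> real) \<Rightarrow> real \<Rightarrow> 'a \<Rightarrow> 'a \<Rightarrow> 'a set \<Rightarrow> real \<Rightarrow> bool" where
  "arc_action V \<alpha> p q C A \<longleftrightarrow> (\<exists>a b x v. a < b \<and> energy_curve a b x v \<and> x a = p \<and> x b = q \<and>
     x ` {a..b} = C \<and> 0 \<notin> C \<and> integral {a..b} (\<lambda>t. lagrangian V \<alpha> (x t) (v t)) = A)"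

lemma continuous_on_potential:
  fixes V :: "'a::euclidean_space \<Rightarrow> real"
  assumes "continuous_on (sphere 0 1) V"
  shows "continuous_on (- {0}) (\<lambda>y. V (y /\<^sub>R norm y) / norm y powr \<alpha>)"
  by (intro continuous_intros continuous_on_compose2[OF assms, of _ "\<lambda>y. y /\<^sub>R norm y"])
    (auto, metis left_inverse norm_eq_zero)

lemma lagrangian_integrable:
  assumes V: "continuous_on (sphere 0 1) V" and x: "energy_curve a b x v" and "0 \<notin> x ` {a..b}"
  shows "(\<lambda>t. lagrangian V \<alpha> (x t) (v t)) absolutely_integrable_on {a..b}"
proof -
  have "(\<lambda>t. 1 / 2 * (norm (v t))\<^sup>2) absolutely_integrable_on {a..b}"
    using absolutely_integrable_scaleR_left[OF energy_curve_square_integrable[OF x], of "1 / 2"] by simp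
  moreover have "(\<lambda>t. V (x t /\<^sub>R norm (x t)) / norm (x t) powr \<alpha>) absolutely_integrable_on {a..b}"
    using assms(3) energy_curveD(4)[OF x]
    by (intro absolutely_integrable_continuous_real continuous_on_compose2[OF continuous_on_potential[OF V]]) auto
  ultimately show ?thesis
    unfolding lagrangian_def by (intro set_integral_add) simp_all
qed

lemma action_eq_integral_lagrangian:
  assumes V: "continuous_on (sphere 0 1) V" and Vnn: "\<forall>s\<in>sphere 0 1. 0 \<le> V s"
    and x: "energy_curve a b x v" and "0 \<notin> x ` {a..b}"
  shows "action V \<alpha> a b x v = ennreal (integral {a..b} (\<lambda>t. lagrangian V \<alpha> (x t) (v t)))"
    and "0 \<le> integral {a..b} (\<lambda>t. lagrangian V \<alpha> (x t) (v t))"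
proof -
  let ?l = "\<lambda>t. lagrangian V \<alpha> (x t) (v t)"
  have i: "?l absolutely_integrable_on {a..b}" by (rule lagrangian_integrable[OF V x assms(4)])
  have x0: "x t \<noteq> 0" if "t \<in> {a..b}" for t using assms(4) that by force
  have pos: "0 \<le> V (x t /\<^sub>R norm (x t)) / norm (x t) powr \<alpha>" if "t \<in> {a..b}" for t
    using x0[OF that] by (intro divide_nonneg_nonneg Vnn[rule_format]) auto
  have nn: "0 \<le> ?l t" if "t \<in> {a..b}" for t
    using pos[OF that] by (simp add: lagrangian_def)
  show "0 \<le> integral {a..b} ?l"
    by (rule integral_nonneg) (use i nn in \<open>auto simp: absolutely_integrable_on_def\<close>)
  have "action V \<alpha> a b x v = (\<integral>\<^sup>+ t. ennreal (?l t) \<partial>lebesgue_on {a..b})"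
    unfolding action_def
  proof (rule nn_integral_cong)
    fix t assume "t \<in> space (lebesgue_on {a..b})"
    then have t: "t \<in> {a..b}" by simp
    show "ennreal (1 / 2 * (norm (v t))\<^sup>2) + potential V \<alpha> (x t) = ennreal (?l t)"
      unfolding potential_def lagrangian_def using x0[OF t] pos[OF t]
      by (simp add: ennreal_plus)
  qed
  also have "\<dots> = ennreal (LINT t|lebesgue_on {a..b}. ?l t)"
    using i nn by (intro nn_integral_eq_integral absolutely_integrable_imp_integrable) auto
  finally show "action V \<alpha> a b x v = ennreal (integral {a..b} ?l)"
    by (simp add: LINT_lebesgue_on_eq_integral[OF i])
qed

text \<open>Translation of time is the transform with \<open>\<Phi> = id\<close> and \<open>\<theta> = 1\<close>; the choice \<open>L = 1\<close> shows that
  the length of the time interval is preserved.\<close>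

lemma energy_curve_shift:
  fixes x :: "real \<Rightarrow> 'a::euclidean_space"
  assumes V: "continuous_on (sphere 0 1) V" and x: "energy_curve a b x v" and "a < b" and "0 \<notin> x ` {a..b}"
  obtains y w where "energy_curve c (c + (b - a)) y w" "y c = x a" "y (c + (b - a)) = x b"
    "y ` {c..c + (b - a)} = x ` {a..b}"
    "integral {c..c + (b - a)} (\<lambda>t. lagrangian V \<alpha> (y t) (w t)) = integral {a..b} (\<lambda>t. lagrangian V \<alpha> (x t) (v t))"
proof -
  obtain d y w where Y: "c < d" "energy_curve c d y w" "y c = x a" "y d = x b" "y ` {c..d} = (\<lambda>y. y) ` x ` {a..b}"
    and L: "\<forall>L :: 'a \<Rightarrow> 'a \<Rightarrow> real. (\<lambda>t. 1 * L (x t) (v t /\<^sub>R 1)) absolutely_integrable_on {a..b} \<longrightarrow>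
       (\<lambda>s. L (y s) (w s)) absolutely_integrable_on {c..d} \<and>
       integral {c..d} (\<lambda>s. L (y s) (w s)) = integral {a..b} (\<lambda>t. 1 * L (x t) (v t /\<^sub>R 1))"
    by (rule energy_curve_transform[OF x \<open>a < b\<close>, of "\<lambda>y. y" "\<lambda>_ h. h" "\<lambda>_. 1" c]) simp_all
  have "integral {c..d} (\<lambda>s. 1::real) = integral {a..b} (\<lambda>s. 1)"
    using L[rule_format, of "\<lambda>_ _. 1"] by simp
  then have "d - c = b - a" using Y(1) \<open>a < b\<close> by simp
  then have d: "d = c + (b - a)" by simp
  have "integral {c..d} (\<lambda>t. lagrangian V \<alpha> (y t) (w t)) = integral {a..b} (\<lambda>t. lagrangian V \<alpha> (x t) (v t))"
    using L[rule_format, of "lagrangian V \<alpha>"] lagrangian_integrable[OF V x assms(4)] by simp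
  then show ?thesis using that[of y w] Y unfolding d by simp
qed

lemma arc_action_join:
  assumes V: "continuous_on (sphere 0 1) V"
    and "arc_action V \<alpha> p q C A" "arc_action V \<alpha> q r C' A'"
  shows "arc_action V \<alpha> p r (C \<union> C') (A + A')"
proof -
  obtain a b x v where x: "a < b" "energy_curve a b x v" "x a = p" "x b = q" "x ` {a..b} = C" "0 \<notin> C"
    "integral {a..b} (\<lambda>t. lagrangian V \<alpha> (x t) (v t)) = A"
    using assms(2) unfolding arc_action_def by blast
  obtain a' b' x' v' where x': "a' < b'" "energy_curve a' b' x' v'" "x' a' = q" "x' b' = r" "x' ` {a'..b'} = C'" "0 \<notin> C'"
    "integral {a'..b'} (\<lambda>t. lagrangian V \<alpha> (x' t) (v' t)) = A'"
    using assms(3) unfolding arc_action_def by blast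
  define c where "c = b + (b' - a')"
  obtain y w where y: "energy_curve b c y w" "y b = q" "y c = r" "y ` {b..c} = C'"
    "integral {b..c} (\<lambda>t. lagrangian V \<alpha> (y t) (w t)) = A'"
    using energy_curve_shift[OF V x'(2,1), of b \<alpha>] x'(3-) unfolding c_def by metis
  have bc: "b < c" using x'(1) by (simp add: c_def)
  let ?z = "\<lambda>t. if t \<le> b then x t else y t" and ?u = "\<lambda>t. if t \<le> b then v t else w t"
  have "energy_curve a c ?z ?u"
    using energy_curve_join[OF _ _ x(2) y(1)] x(1) bc x(4) y(2) by simp
  moreover have "?z ` {a..c} = C \<union> C'"
  proof -
    have "{a..c} = {a..b} \<union> {b..c}" using x(1) bc by auto
    moreover have "?z ` {a..b} = C" unfolding x(5)[symmetric] by (rule image_cong) auto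
    moreover have "?z ` {b..c} = C'" unfolding y(4)[symmetric] by (rule image_cong) (use x(4) y(2) in auto)
    ultimately show ?thesis by (simp only: image_Un)
  qed
  moreover have "integral {a..c} (\<lambda>t. lagrangian V \<alpha> (?z t) (?u t)) = A + A'"
  proof -
    have eq: "(\<lambda>t. lagrangian V \<alpha> (?z t) (?u t)) = (\<lambda>t. if t \<le> b then lagrangian V \<alpha> (x t) (v t) else lagrangian V \<alpha> (y t) (w t))"
      by auto
    show ?thesis
      unfolding eq using x y bc x'(6) by (subst absolutely_integrable_join(2)) (auto intro!: lagrangian_integrable V)
  qed
  moreover have "?z a = p" "?z c = r" using x y bc by auto
  ultimately show ?thesis
    unfolding arc_action_def using x(1,6) x'(6) bc
    by (intro exI[of _ a] exI[of _ c] exI[of _ ?z] exI[of _ ?u]) auto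
qed

lemma arc_action_transform:
  fixes \<Phi> :: "'a::euclidean_space \<Rightarrow> 'a" and \<theta> :: "'a \<Rightarrow> real"
  assumes V: "continuous_on (sphere 0 1) V" and arc: "arc_action V \<alpha> p q C A"
    and deriv: "\<And>y. y \<noteq> 0 \<Longrightarrow> (\<Phi> has_derivative D y) (at y)"
    and cont: "\<And>h. continuous_on (- {0}) (\<lambda>y. D y h)"
    and \<theta>: "continuous_on (- {0}) \<theta>" "\<And>y. y \<noteq> 0 \<Longrightarrow> 0 < \<theta> y"
    and \<Phi>0: "\<And>y. y \<noteq> 0 \<Longrightarrow> \<Phi> y \<noteq> 0"
    and le: "\<And>y h. y \<noteq> 0 \<Longrightarrow> \<theta> y * lagrangian V \<beta> (\<Phi> y) (D y h /\<^sub>R \<theta> y) \<le> k * lagrangian V \<alpha> y h"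
  obtains A' where "A' \<le> k * A" "arc_action V \<beta> (\<Phi> p) (\<Phi> q) (\<Phi> ` C) A'"
proof -
  obtain a b x v where x: "a < b" "energy_curve a b x v" "x a = p" "x b = q" "x ` {a..b} = C" "0 \<notin> C"
    "integral {a..b} (\<lambda>t. lagrangian V \<alpha> (x t) (v t)) = A"
    using arc unfolding arc_action_def by blast
  have x0: "x t \<noteq> 0" if "t \<in> {a..b}" for t using x(5,6) that by force
  have cx: "continuous_on {a..b} (\<lambda>t. g (x t))" if "continuous_on (- {0}) g" for g :: "'a \<Rightarrow> 'c::topological_space"
    by (rule continuous_on_compose2[OF that energy_curveD(4)[OF x(2)]]) (use x0 in auto)
  have lin: "linear (D y)" if "y \<noteq> 0" for y using deriv[OF that] has_derivative_linear by blast
  have h: "\<And>t. t \<in> {a..b} \<Longrightarrow> (\<Phi> has_derivative D (x t)) (at (x t))"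
    "\<And>h. continuous_on {a..b} (\<lambda>t. D (x t) h)"
    "continuous_on {a..b} (\<lambda>t. \<theta> (x t))" "\<And>t. t \<in> {a..b} \<Longrightarrow> 0 < \<theta> (x t)"
    using deriv x0 \<theta>(2) by (auto intro!: cx cont \<theta>(1))
  obtain d y w where Y: "0 < d" "energy_curve 0 d y w" "y 0 = \<Phi> (x a)" "y d = \<Phi> (x b)" "y ` {0..d} = \<Phi> ` x ` {a..b}"
    and L: "\<forall>L :: 'a \<Rightarrow> 'a \<Rightarrow> real. (\<lambda>t. \<theta> (x t) * L (\<Phi> (x t)) (D (x t) (v t) /\<^sub>R \<theta> (x t))) absolutely_integrable_on {a..b} \<longrightarrow>
       (\<lambda>s. L (y s) (w s)) absolutely_integrable_on {0..d} \<and>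
       integral {0..d} (\<lambda>s. L (y s) (w s)) = integral {a..b} (\<lambda>t. \<theta> (x t) * L (\<Phi> (x t)) (D (x t) (v t) /\<^sub>R \<theta> (x t)))"
    by (rule energy_curve_transform[OF x(2,1) h, where c = 0])
  have y0: "0 \<notin> y ` {0..d}" unfolding Y(5) using x0 \<Phi>0 by force
  let ?l = "\<lambda>t. \<theta> (x t) * lagrangian V \<beta> (\<Phi> (x t)) (D (x t) (v t) /\<^sub>R \<theta> (x t))"
  have i: "?l absolutely_integrable_on {a..b}"
  proof -
    have sq: "(\<lambda>t. (norm (D (x t) (v t)))\<^sup>2) absolutely_integrable_on {a..b}"
      by (rule square_integrable_continuous_linear[OF energy_curveD(2,3)[OF x(2)] lin[OF x0] cx[OF cont]])
    have "continuous_on {a..b} (\<lambda>t. 1 / (2 * \<theta> (x t)))"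
      using less_imp_neq[OF h(4)] by (intro continuous_intros cx \<theta>(1)) simp
    then have 1: "(\<lambda>t. 1 / (2 * \<theta> (x t)) * (norm (D (x t) (v t)))\<^sup>2) absolutely_integrable_on {a..b}"
    proof (intro absolutely_integrable_continuous_linear[OF sq, of "\<lambda>t r. 1 / (2 * \<theta> (x t)) * r"])
      show "linear (\<lambda>r. 1 / (2 * \<theta> (x t)) * r)" for t
        by (simp add: linear_iff add_divide_distrib)
      show "continuous_on {a..b} (\<lambda>t. 1 / (2 * \<theta> (x t)) * r)" for r
        using \<open>continuous_on {a..b} (\<lambda>t. 1 / (2 * \<theta> (x t)))\<close> by (rule continuous_on_mult_right)
    qed
    have "continuous_on (- {0}) \<Phi>"
      using deriv by (intro continuous_at_imp_continuous_on) (auto dest: has_derivative_continuous)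
    then have 2: "(\<lambda>t. \<theta> (x t) * (V (\<Phi> (x t) /\<^sub>R norm (\<Phi> (x t))) / norm (\<Phi> (x t)) powr \<beta>)) absolutely_integrable_on {a..b}"
      using x0 \<Phi>0 by (intro absolutely_integrable_continuous_real continuous_intros cx[OF \<theta>(1)]
        continuous_on_compose2[OF continuous_on_potential[OF V] cx[of \<Phi>]]) auto
    have "?l t = 1 / (2 * \<theta> (x t)) * (norm (D (x t) (v t)))\<^sup>2 + \<theta> (x t) * (V (\<Phi> (x t) /\<^sub>R norm (\<Phi> (x t))) / norm (\<Phi> (x t)) powr \<beta>)"
      if "t \<in> {a..b}" for t
      using \<theta>(2)[OF x0[OF that]] by (simp add: lagrangian_def distrib_left) (simp add: field_simps power2_eq_square)
    then show ?thesis
      by (intro absolutely_integrable_spike[OF set_integral_add(1)[OF 1 2], of "{}"]) auto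
  qed
  have "integral {a..b} ?l \<le> integral {a..b} (\<lambda>t. k * lagrangian V \<alpha> (x t) (v t))"
    using i lagrangian_integrable[OF V x(2), of \<alpha>] x(5,6) x0
    by (intro integral_le le integrable_on_mult_right) (auto simp: absolutely_integrable_on_def)
  then have "integral {0..d} (\<lambda>s. lagrangian V \<beta> (y s) (w s)) \<le> k * A"
    using L[rule_format, OF i] x(7) by simp
  then show ?thesis
    using that[of "integral {0..d} (\<lambda>s. lagrangian V \<beta> (y s) (w s))"] Y x y0
    unfolding arc_action_def by blast
qed

definition arc_actions ::
    "'a::euclidean_space \<Rightarrow> 'a \<Rightarrow> ('a \<Rightarrow> real) \<Rightarrow> real \<Rightarrow> real \<Rightarrow> real set" where
  "arc_actions \<xi>m \<xi>p V \<alpha> \<epsilon> =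
     {A. \<exists>C. arc_action V \<alpha> \<xi>m \<xi>p C A \<and> (\<forall>y\<in>C. \<epsilon> \<le> norm y) \<and> (\<exists>y\<in>C. norm y = \<epsilon>)}"

text \<open>The weak formulation of the level reduces to real actions of arcs: the action of an \<open>H\<^sup>1\<close> curve that
  avoids the origin is finite, and every arc can be moved to a symmetric time interval.\<close>

lemma m_level_eq_INF:
  assumes V: "continuous_on (sphere 0 1) V" and Vnn: "\<forall>s\<in>sphere 0 1. 0 \<le> V s" and "0 < \<epsilon>"
  shows "m_level \<xi>m \<xi>p Vmin V \<alpha> \<epsilon> = (INF A\<in>arc_actions \<xi>m \<xi>p V \<alpha> \<epsilon>. ereal A)"
proof -
  have nn: "0 \<le> A" if "A \<in> arc_actions \<xi>m \<xi>p V \<alpha> \<epsilon>" for A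
    using that action_eq_integral_lagrangian(2)[OF V Vnn] unfolding arc_actions_def arc_action_def by blast
  have "{action V \<alpha> (- T) T x v | T x v. admissible \<xi>m \<xi>p \<epsilon> T x v} = ennreal ` arc_actions \<xi>m \<xi>p V \<alpha> \<epsilon>"
  proof (intro equalityI subsetI)
    fix z assume "z \<in> {action V \<alpha> (- T) T x v | T x v. admissible \<xi>m \<xi>p \<epsilon> T x v}"
    then obtain T x v where z: "z = action V \<alpha> (- T) T x v" and adm: "admissible \<xi>m \<xi>p \<epsilon> T x v" by blast
    have T: "0 < T" and x: "energy_curve (- T) T x v"
      using adm H1_curve_iff_energy_curve[of "- T" T x v] by (auto simp: admissible_def)
    have x0: "0 \<notin> x ` {-T..T}" using adm \<open>0 < \<epsilon>\<close> by (force simp: admissible_def)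
    have "arc_action V \<alpha> \<xi>m \<xi>p (x ` {-T..T}) (integral {-T..T} (\<lambda>t. lagrangian V \<alpha> (x t) (v t)))"
      unfolding arc_action_def using adm T x x0
      by (intro exI[of _ "-T"] exI[of _ T] exI[of _ x] exI[of _ v]) (auto simp: admissible_def)
    then have "integral {-T..T} (\<lambda>t. lagrangian V \<alpha> (x t) (v t)) \<in> arc_actions \<xi>m \<xi>p V \<alpha> \<epsilon>"
      using adm unfolding arc_actions_def admissible_def by blast
    then show "z \<in> ennreal ` arc_actions \<xi>m \<xi>p V \<alpha> \<epsilon>"
      unfolding z action_eq_integral_lagrangian(1)[OF V Vnn x x0] by (rule imageI)
  next
    fix z assume "z \<in> ennreal ` arc_actions \<xi>m \<xi>p V \<alpha> \<epsilon>"
    then obtain A C where z: "z = ennreal A" "arc_action V \<alpha> \<xi>m \<xi>p C A" "\<forall>y\<in>C. \<epsilon> \<le> norm y" "\<exists>y\<in>C. norm y = \<epsilon>"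
      unfolding arc_actions_def by blast
    then obtain a b x v where x: "a < b" "energy_curve a b x v" "x a = \<xi>m" "x b = \<xi>p" "x ` {a..b} = C" "0 \<notin> C"
      "integral {a..b} (\<lambda>t. lagrangian V \<alpha> (x t) (v t)) = A"
      unfolding arc_action_def by blast
    define T where "T = (b - a) / 2"
    have T: "0 < T" "- T + (b - a) = T" using x(1) by (auto simp: T_def field_simps)
    obtain y w where y: "energy_curve (- T) T y w" "y (- T) = \<xi>m" "y T = \<xi>p" "y ` {- T..T} = C"
      "integral {- T..T} (\<lambda>t. lagrangian V \<alpha> (y t) (w t)) = A"
      using energy_curve_shift[OF V x(2,1), of "- T" \<alpha>] x(3-) unfolding T(2) by metis
    have adm: "admissible \<xi>m \<xi>p \<epsilon> T y w"
      using y T z(3,4) H1_curve_iff_energy_curve[of "- T" T y w] unfolding admissible_def y(4)[symmetric] by auto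
    have "z = action V \<alpha> (- T) T y w"
      using action_eq_integral_lagrangian(1)[OF V Vnn y(1)] x(6) y(4,5) z(1) by simp
    with adm show "z \<in> {action V \<alpha> (- T) T x v | T x v. admissible \<xi>m \<xi>p \<epsilon> T x v}" by blast
  qed
  moreover have "enn2ereal ` ennreal ` arc_actions \<xi>m \<xi>p V \<alpha> \<epsilon> = ereal ` arc_actions \<xi>m \<xi>p V \<alpha> \<epsilon>"
    unfolding image_image by (rule image_cong) (use nn in \<open>auto simp: enn2ereal_ennreal\<close>)
  ultimately show ?thesis
    using \<open>0 < \<epsilon>\<close> by (simp add: m_level_def Inf_ennreal.rep_eq)
qed

lemma INF_ereal_affine:
  fixes S :: "real set"
  assumes "0 < c"
  shows "((INF A\<in>S. ereal A) - ereal m) / ereal c = (INF A\<in>S. ereal ((A - m) / c))"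
proof (rule antisym)
  show "((INF A\<in>S. ereal A) - ereal m) / ereal c \<le> (INF A\<in>S. ereal ((A - m) / c))"
  proof (rule INF_greatest)
    fix A assume "A \<in> S"
    then have "(INF A\<in>S. ereal A) \<le> ereal A" by (rule INF_lower)
    then show "((INF A\<in>S. ereal A) - ereal m) / ereal c \<le> ereal ((A - m) / c)"
      using assms by (cases "INF A\<in>S. ereal A") (auto simp: divide_right_mono)
  qed
  show "(INF A\<in>S. ereal ((A - m) / c)) \<le> ((INF A\<in>S. ereal A) - ereal m) / ereal c"
  proof -
    define R where "R = (INF A\<in>S. ereal ((A - m) / c))"
    have "R * ereal c + ereal m \<le> (INF A\<in>S. ereal A)"
    proof (rule INF_greatest)
      fix A assume "A \<in> S"
      then have "R \<le> ereal ((A - m) / c)" unfolding R_def by (rule INF_lower)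
      then show "R * ereal c + ereal m \<le> ereal A"
        using assms by (cases R) (auto simp: field_simps)
    qed
    then have "R \<le> ((INF A\<in>S. ereal A) - ereal m) / ereal c"
      using assms by (cases R; cases "INF A\<in>S. ereal A") (auto simp: field_simps)
    then show ?thesis by (simp add: R_def)
  qed
qed

lemma gam_eq_INF:
  assumes "continuous_on (sphere 0 1) V" and "\<forall>s\<in>sphere 0 1. 0 \<le> V s" and "0 < \<epsilon>"
  shows "gam \<xi>m \<xi>p Vmin V \<alpha> \<epsilon> = (INF A\<in>arc_actions \<xi>m \<xi>p V \<alpha> \<epsilon>.
     ereal ((A - 2 / alpha_star \<alpha> * sqrt (2 * Vmin)) / \<epsilon> powr alpha_star \<alpha>))"
proof -
  have "m_level \<xi>m \<xi>p Vmin V \<alpha> 0 = ereal (2 / alpha_star \<alpha> * sqrt (2 * Vmin))"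
    by (simp add: m_level_def)
  then show ?thesis
    using INF_ereal_affine[of "\<epsilon> powr alpha_star \<alpha>"] m_level_eq_INF[OF assms] \<open>0 < \<epsilon>\<close>
    by (simp add: gam_def)
qed

section \<open>Comparison arcs: radial powers, homotheties and radial motions\<close>

text \<open>A primitive of \<open>r powr (- \<alpha> / 2)\<close>, the direction \<open>y / |y|\<close> and the radial powers are all built from
  powers of the norm.\<close>

lemma has_derivative_norm_powr:
  fixes y :: "'a::euclidean_space"
  assumes "y \<noteq> 0"
  shows "((\<lambda>y. norm y powr \<beta>) has_derivative (\<lambda>h. \<beta> * norm y powr (\<beta> - 2) * (y \<bullet> h))) (at y)"
proof -
  have r: "norm y > 0" using assms by simp
  have "((\<lambda>y. norm y powr \<beta>) has_derivative (\<lambda>h. (h \<bullet> sgn y) * (\<beta> * norm y powr (\<beta> - 1)))) (at y)"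
    by (rule DERIV_compose_FDERIV[OF has_real_derivative_powr[OF r] has_derivative_norm[OF assms]])
  moreover have "(h \<bullet> sgn y) * (\<beta> * norm y powr (\<beta> - 1)) = \<beta> * norm y powr (\<beta> - 2) * (y \<bullet> h)" for h
  proof -
    have "norm y powr (\<beta> - 1) = norm y powr (\<beta> - 2) * norm y"
      using r powr_add[of "norm y" "\<beta> - 2" 1] by simp
    then show ?thesis using r by (simp add: sgn_div_norm inner_commute)
  qed
  ultimately show ?thesis by simp
qed

definition radial_power :: "real \<Rightarrow> 'a::euclidean_space \<Rightarrow> 'a" where
  "radial_power \<beta> y = norm y powr \<beta> *\<^sub>R y"

definition radial_power_derivative :: "real \<Rightarrow> 'a::euclidean_space \<Rightarrow> 'a \<Rightarrow> 'a" where
  "radial_power_derivative \<beta> y h = norm y powr \<beta> *\<^sub>R h + (\<beta> * norm y powr (\<beta> - 2) * (y \<bullet> h)) *\<^sub>R y"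

lemma has_derivative_radial_power:
  assumes "y \<noteq> 0"
  shows "(radial_power \<beta> has_derivative radial_power_derivative \<beta> y) (at y)"
  unfolding radial_power_def[abs_def] radial_power_derivative_def[abs_def]
  by (rule has_derivative_scaleR[OF has_derivative_norm_powr[OF assms] has_derivative_ident])

lemma continuous_on_radial_power_derivative:
  "continuous_on (- {0}) (\<lambda>y. radial_power_derivative \<beta> y h)"
  unfolding radial_power_derivative_def by (intro continuous_intros) auto

lemma norm_radial_power_derivative_le:
  assumes "0 \<le> \<beta>" "y \<noteq> 0"
  shows "norm (radial_power_derivative \<beta> y h) \<le> (1 + \<beta>) * norm y powr \<beta> * norm h"
proof -
  have r: "norm y > 0" using assms by simp
  have p: "norm y powr \<beta> = norm y powr (\<beta> - 2) * norm y * norm y"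
    using r powr_add[of "norm y" "\<beta> - 2" 2] by (simp add: power2_eq_square)
  have "norm ((\<beta> * norm y powr (\<beta> - 2) * (y \<bullet> h)) *\<^sub>R y) = \<beta> * norm y powr (\<beta> - 2) * norm y * \<bar>y \<bullet> h\<bar>"
    using assms by (simp add: abs_mult)
  also have "\<dots> \<le> \<beta> * norm y powr (\<beta> - 2) * norm y * (norm y * norm h)"
    using assms by (intro mult_left_mono Cauchy_Schwarz_ineq2) auto
  finally have "norm ((\<beta> * norm y powr (\<beta> - 2) * (y \<bullet> h)) *\<^sub>R y) \<le> \<beta> * norm y powr \<beta> * norm h"
    by (simp add: p mult_ac)
  then show ?thesis
    unfolding radial_power_derivative_def
    using norm_triangle_ineq[of "norm y powr \<beta> *\<^sub>R h" "(\<beta> * norm y powr (\<beta> - 2) * (y \<bullet> h)) *\<^sub>R y"]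
    by (simp add: algebra_simps)
qed

lemma norm_radial_power: "y \<noteq> 0 \<Longrightarrow> norm (radial_power \<beta> y) = norm y powr (1 + \<beta>)"
  by (simp add: radial_power_def powr_add mult.commute)

lemma direction_radial_power: "radial_power \<beta> y /\<^sub>R norm (radial_power \<beta> y) = y /\<^sub>R norm y"
  by (cases "y = 0") (auto simp: radial_power_def)

text \<open>Exponents are compared by \<open>y \<mapsto> |y| powr (b - 1) *\<^sub>R y\<close> and the change of time with speed
  \<open>b * |y| powr (2 * b - 2)\<close>. Let \<open>k = 1 / alpha_star \<alpha>\<close>. In the variables \<open>\<rho> = |y| powr alpha_star \<alpha>\<close> and \<open>s = y / |y|\<close>, and
  in a time that turns the potential term into \<open>k * V s\<close>, the action divided by \<open>k\<close> is the integral of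
  \<open>(\<rho>'\<^sup>2 + \<rho>\<^sup>2 |s'|\<^sup>2 / k\<^sup>2) / 2 + V s\<close>. This integrand decreases in \<open>k\<close>, so passing
  from \<open>\<alpha>1\<close> to \<open>\<alpha>2 \<ge> \<alpha>1\<close> multiplies the action by at most the quotient \<open>b\<close> of the two values of \<open>k\<close>.
  In the original variables this is the bound of the derivative of the map by \<open>b * |y| powr (b - 1)\<close>.\<close>

lemma arc_actions_radial_power:
  fixes V :: "'a::euclidean_space \<Rightarrow> real"
  assumes V: "continuous_on (sphere 0 1) V" and "norm \<xi>m = 1" "norm \<xi>p = 1" and "0 < \<epsilon>"
    and "1 \<le> b" and b: "b * alpha_star \<alpha>2 = alpha_star \<alpha>1"
    and A: "A \<in> arc_actions \<xi>m \<xi>p V \<alpha>1 \<epsilon>"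
  obtains A' where "A' \<le> b * A" "A' \<in> arc_actions \<xi>m \<xi>p V \<alpha>2 (\<epsilon> powr b)"
proof -
  obtain C where C: "arc_action V \<alpha>1 \<xi>m \<xi>p C A" "\<forall>y\<in>C. \<epsilon> \<le> norm y" "\<exists>y\<in>C. norm y = \<epsilon>"
    using A unfolding arc_actions_def by blast
  let ?\<theta> = "\<lambda>y::'a. b * norm y powr (2 * b - 2)"
  have "\<exists>A'. A' \<le> b * A \<and> arc_action V \<alpha>2 (radial_power (b - 1) \<xi>m) (radial_power (b - 1) \<xi>p) (radial_power (b - 1) ` C) A'"
  proof (rule arc_action_transform[OF V C(1), where \<Phi> = "radial_power (b - 1)" and D = "radial_power_derivative (b - 1)"
        and \<theta> = ?\<theta> and \<beta> = \<alpha>2 and k = b])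
    show "(radial_power (b - 1) has_derivative radial_power_derivative (b - 1) y) (at y)" if "y \<noteq> 0" for y :: 'a
      by (rule has_derivative_radial_power[OF that])
    show "continuous_on (- {0}) (\<lambda>y. radial_power_derivative (b - 1) y h)" for h :: 'a
      by (rule continuous_on_radial_power_derivative)
    show "continuous_on (- {0}) ?\<theta>" by (intro continuous_intros) auto
    show "0 < ?\<theta> y" if "y \<noteq> 0" for y using that \<open>1 \<le> b\<close> by simp
    show "radial_power (b - 1) y \<noteq> 0" if "y \<noteq> 0" for y :: 'a using that by (simp add: radial_power_def)
    show "?\<theta> y * lagrangian V \<alpha>2 (radial_power (b - 1) y) (radial_power_derivative (b - 1) y h /\<^sub>R ?\<theta> y)
        \<le> b * lagrangian V \<alpha>1 y h" if y: "y \<noteq> 0" for y h :: 'a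
    proof -
      define r where "r = norm y"
      have r: "r > 0" using y by (simp add: r_def)
      have \<theta>: "?\<theta> y > 0" using y \<open>1 \<le> b\<close> by simp
      have sq: "(r powr (b - 1))\<^sup>2 = r powr (2 * b - 2)"
        using r by (simp add: powr_power algebra_simps)
      define n where "n = norm (radial_power_derivative (b - 1) y h)"
      have "n \<le> b * r powr (b - 1) * norm h"
        unfolding n_def r_def using norm_radial_power_derivative_le[of "b - 1" y h] y \<open>1 \<le> b\<close> by simp
      then have "n\<^sup>2 \<le> (b * r powr (b - 1) * norm h)\<^sup>2" by (rule power_mono) (simp add: n_def)
      also have "\<dots> = b * ?\<theta> y * (norm h)\<^sup>2"
        unfolding power_mult_distrib sq by (simp add: r_def power2_eq_square)
      finally have kin: "?\<theta> y * (1 / 2 * (n / ?\<theta> y)\<^sup>2) \<le> b * (1 / 2 * (norm h)\<^sup>2)"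
        using \<theta> y \<open>1 \<le> b\<close> by (simp add: field_simps power2_eq_square)
      have "b * (2 - \<alpha>2) = 2 - \<alpha>1" using b by (simp add: alpha_star_def)
      then have e: "2 * b - 2 = b * \<alpha>2 - \<alpha>1" by (simp add: algebra_simps)
      have "r powr (2 * b - 2) = r powr (b * \<alpha>2) / r powr \<alpha>1" unfolding e by (simp add: powr_diff)
      then have pot: "?\<theta> y * (V (y /\<^sub>R norm y) / (r powr b) powr \<alpha>2) = b * (V (y /\<^sub>R norm y) / norm y powr \<alpha>1)"
        using r by (simp add: r_def[symmetric] powr_powr)
      have nd: "norm (radial_power_derivative (b - 1) y h /\<^sub>R ?\<theta> y) = n / ?\<theta> y"
        unfolding norm_scaleR abs_of_pos[OF positive_imp_inverse_positive[OF \<theta>]]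
        by (simp add: n_def divide_inverse mult.commute)
      have nr: "norm (radial_power (b - 1) y) = r powr b"
        using norm_radial_power[OF y, of "b - 1"] by (simp add: r_def)
      have "?\<theta> y * lagrangian V \<alpha>2 (radial_power (b - 1) y) (radial_power_derivative (b - 1) y h /\<^sub>R ?\<theta> y)
        = ?\<theta> y * (1 / 2 * (n / ?\<theta> y)\<^sup>2) + ?\<theta> y * (V (y /\<^sub>R norm y) / (r powr b) powr \<alpha>2)"
        unfolding lagrangian_def nd nr direction_radial_power[of "b - 1" y, unfolded nr] by (rule distrib_left)
      also have "\<dots> \<le> b * (1 / 2 * (norm h)\<^sup>2) + b * (V (y /\<^sub>R norm y) / norm y powr \<alpha>1)"
        unfolding pot using kin by simp
      finally show ?thesis by (simp only: lagrangian_def distrib_left)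
    qed
  qed blast+
  then obtain A' where A': "A' \<le> b * A" "arc_action V \<alpha>2 \<xi>m \<xi>p (radial_power (b - 1) ` C) A'"
    using assms(2,3) by (auto simp: radial_power_def)
  have nr: "norm (radial_power (b - 1) y) = norm y powr b" if "y \<in> C" for y
    using norm_radial_power[of y "b - 1"] C(2) that \<open>0 < \<epsilon>\<close> by force
  have "A' \<in> arc_actions \<xi>m \<xi>p V \<alpha>2 (\<epsilon> powr b)"
    unfolding arc_actions_def
  proof (intro CollectI exI[of _ "radial_power (b - 1) ` C"] conjI)
    show "arc_action V \<alpha>2 \<xi>m \<xi>p (radial_power (b - 1) ` C) A'" by (rule A'(2))
    show "\<forall>y\<in>radial_power (b - 1) ` C. \<epsilon> powr b \<le> norm y"
      using C(2) \<open>0 < \<epsilon>\<close> \<open>1 \<le> b\<close> by (auto simp: nr intro!: powr_mono2)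
    show "\<exists>y\<in>radial_power (b - 1) ` C. norm y = \<epsilon> powr b"
      using C(3) nr by (auto intro!: bexI[rotated])
  qed
  with A'(1) show ?thesis by (rule that)
qed

text \<open>The homogeneity of the problem: with the speed of time \<open>l powr ((2 + \<alpha>) / 2)\<close>, kinetic and
  potential energy acquire the same factor.\<close>

lemma arc_action_scale:
  fixes V :: "'a::euclidean_space \<Rightarrow> real"
  assumes V: "continuous_on (sphere 0 1) V" and "0 < l" and arc: "arc_action V \<alpha> p q C A"
  obtains A' where "A' \<le> l powr alpha_star \<alpha> * A" "arc_action V \<alpha> (l *\<^sub>R p) (l *\<^sub>R q) ((*\<^sub>R) l ` C) A'"
proof (rule arc_action_transform[OF V arc, of "(*\<^sub>R) l" "\<lambda>_. (*\<^sub>R) l" "\<lambda>_. l powr ((2 + \<alpha>) / 2)" \<alpha> "l powr alpha_star \<alpha>"])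
  show "((*\<^sub>R) l has_derivative (*\<^sub>R) l) (at y)" for y :: 'a
    by (auto intro!: derivative_eq_intros)
  show "l powr ((2 + \<alpha>) / 2) * lagrangian V \<alpha> (l *\<^sub>R y) ((l *\<^sub>R h) /\<^sub>R l powr ((2 + \<alpha>) / 2))
      \<le> l powr alpha_star \<alpha> * lagrangian V \<alpha> y h" if "y \<noteq> 0" for y h :: 'a
  proof -
    have d: "l *\<^sub>R y /\<^sub>R norm (l *\<^sub>R y) = y /\<^sub>R norm y" using \<open>0 < l\<close> by simp
    define k where "k = l powr ((2 + \<alpha>) / 2)"
    have k: "k > 0" using \<open>0 < l\<close> by (simp add: k_def)
    have k1: "l powr alpha_star \<alpha> * k = l\<^sup>2"
      using \<open>0 < l\<close> by (simp add: k_def alpha_star_def flip: powr_add) (simp add: field_simps)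
    have k2: "k = l powr alpha_star \<alpha> * l powr \<alpha>"
      by (simp add: k_def alpha_star_def flip: powr_add) (simp add: field_simps)
    have "k * lagrangian V \<alpha> (l *\<^sub>R y) ((l *\<^sub>R h) /\<^sub>R k) = l\<^sup>2 / k * (1 / 2 * (norm h)\<^sup>2) + k / l powr \<alpha> * (V (y /\<^sub>R norm y) / norm y powr \<alpha>)"
      using \<open>0 < l\<close> k unfolding lagrangian_def d
      by (simp add: powr_mult power_mult_distrib field_simps power2_eq_square)
    also have "l\<^sup>2 / k = l powr alpha_star \<alpha>" using k1 k by (simp add: field_simps)
    also have "k / l powr \<alpha> = l powr alpha_star \<alpha>" using k2 \<open>0 < l\<close> by (simp add: field_simps)
    finally show ?thesis by (simp add: k_def lagrangian_def distrib_left)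
  qed
qed (use \<open>0 < l\<close> that in \<open>auto intro!: continuous_intros\<close>)

text \<open>Radial motion over a minimum of \<open>V\<close> on the sphere at zero energy: the speed of time is chosen such that kinetic
  and potential energy agree, and then the Lagrangian is the derivative of a power of the radius.
  The sign \<open>\<sigma>\<close> covers motion away from the origin and towards it.\<close>

lemma arc_action_radial:
  fixes V :: "'a::euclidean_space \<Rightarrow> real"
  assumes V: "continuous_on (sphere 0 1) V" and \<xi>: "norm \<xi> = 1" "V \<xi> = Vmin" "0 < Vmin"
    and \<alpha>: "0 < alpha_star \<alpha>" and "a < b" and \<sigma>: "\<sigma> = 1 \<or> \<sigma> = -1" and pos: "\<And>t. t \<in> {a..b} \<Longrightarrow> 0 < \<sigma> * t"
  shows "arc_action V \<alpha> ((\<sigma> * a) *\<^sub>R \<xi>) ((\<sigma> * b) *\<^sub>R \<xi>) ((\<lambda>t. (\<sigma> * t) *\<^sub>R \<xi>) ` {a..b})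
     (sqrt (2 * Vmin) * \<sigma> * ((\<sigma> * b) powr alpha_star \<alpha> - (\<sigma> * a) powr alpha_star \<alpha>) / alpha_star \<alpha>)"
proof -
  let ?x = "\<lambda>t. (\<sigma> * t) *\<^sub>R \<xi>" and ?\<theta> = "\<lambda>t. (\<sigma> * t) powr (\<alpha> / 2) / sqrt (2 * Vmin)"
  have curve: "energy_curve a b ?x (\<lambda>_. \<sigma> *\<^sub>R \<xi>)"
    unfolding energy_curve_def primitive_on_def
    by (auto simp: algebra_simps)
  have nz: "t \<noteq> 0" if "t \<in> {a..b}" for t using pos[OF that] by auto
  have c: "continuous_on {a..b} ?\<theta>"
    using nz \<sigma> \<xi>(3) by (intro continuous_intros) auto
  have p: "0 < ?\<theta> t" if "t \<in> {a..b}" for t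
  proof -
    have "\<sigma> * t \<noteq> 0" using pos[OF that] by linarith
    then show ?thesis using \<xi>(3) by (intro divide_pos_pos powr_gt_zero[THEN iffD2]) simp_all
  qed
  obtain d y w where Y: "0 < d" "energy_curve 0 d y w" "y 0 = ?x a" "y d = ?x b" "y ` {0..d} = (\<lambda>y. y) ` ?x ` {a..b}"
    and L: "\<forall>L :: 'a \<Rightarrow> 'a \<Rightarrow> real. (\<lambda>t. ?\<theta> t * L (?x t) ((\<sigma> *\<^sub>R \<xi>) /\<^sub>R ?\<theta> t)) absolutely_integrable_on {a..b} \<longrightarrow>
       (\<lambda>s. L (y s) (w s)) absolutely_integrable_on {0..d} \<and>
       integral {0..d} (\<lambda>s. L (y s) (w s)) = integral {a..b} (\<lambda>t. ?\<theta> t * L (?x t) ((\<sigma> *\<^sub>R \<xi>) /\<^sub>R ?\<theta> t))"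
    by (rule energy_curve_transform[OF curve \<open>a < b\<close> has_derivative_ident continuous_on_const c p, where c = 0])
  let ?f = "\<lambda>t. sqrt (2 * Vmin) * (\<sigma> * t) powr (- \<alpha> / 2)"
  have eq: "?\<theta> t * lagrangian V \<alpha> (?x t) ((\<sigma> *\<^sub>R \<xi>) /\<^sub>R ?\<theta> t) = ?f t" if t: "t \<in> {a..b}" for t
  proof -
    define r where "r = \<sigma> * t"
    have r: "r > 0" using pos[OF t] by (simp add: r_def)
    define k where "k = sqrt (2 * Vmin)"
    have k: "k > 0" "Vmin = k * k / 2" using \<xi>(3) by (auto simp: k_def)
    define z where "z = r powr (\<alpha> / 2)"
    have z: "z > 0" "r powr \<alpha> = z * z" "r powr (- \<alpha> / 2) = 1 / z"
      using r by (auto simp: z_def powr_minus_divide simp flip: powr_add)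
    have "\<bar>\<sigma>\<bar> = 1" using \<sigma> by auto
    then have n: "norm ((\<sigma> *\<^sub>R \<xi>) /\<^sub>R (z / k)) = k / z"
      using z(1) k(1) \<xi>(1) by (simp add: abs_mult divide_inverse mult.commute)
    have "lagrangian V \<alpha> (r *\<^sub>R \<xi>) ((\<sigma> *\<^sub>R \<xi>) /\<^sub>R (z / k)) = 1 / 2 * (k / z)\<^sup>2 + Vmin / (z * z)"
      unfolding lagrangian_def n using r z(2) \<xi>(1,2) by simp
    also have "\<dots> = k * k / (z * z)" using z(1) unfolding k(2) by (simp add: power2_eq_square)
    finally have "z / k * lagrangian V \<alpha> (r *\<^sub>R \<xi>) ((\<sigma> *\<^sub>R \<xi>) /\<^sub>R (z / k)) = k * (1 / z)"
      using z(1) k(1) by simp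
    then show ?thesis unfolding z(3)[symmetric] by (simp add: r_def z_def k_def)
  qed
  have cf: "continuous_on {a..b} ?f"
    using nz \<sigma> by (intro continuous_intros) auto
  have i: "(\<lambda>t. ?\<theta> t * lagrangian V \<alpha> (?x t) ((\<sigma> *\<^sub>R \<xi>) /\<^sub>R ?\<theta> t)) absolutely_integrable_on {a..b}"
    by (rule absolutely_integrable_spike[OF absolutely_integrable_continuous_real[OF cf], of "{}"]) (use eq in auto)
  let ?F = "\<lambda>t. sqrt (2 * Vmin) * \<sigma> / alpha_star \<alpha> * (\<sigma> * t) powr alpha_star \<alpha>"
  have "(?f has_integral ?F b - ?F a) {a..b}"
  proof (rule fundamental_theorem_of_calculus)
    fix t assume t: "t \<in> {a..b}"
    have e: "alpha_star \<alpha> - 1 = - \<alpha> / 2" by (simp add: alpha_star_def field_simps)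
    have "((\<lambda>t. (\<sigma> * t) powr alpha_star \<alpha>) has_real_derivative alpha_star \<alpha> * (\<sigma> * t) powr (- \<alpha> / 2) * \<sigma>) (at t within {a..b})"
      using DERIV_chain2[OF has_real_derivative_powr[OF pos[OF t], of "alpha_star \<alpha>"] DERIV_cmult_Id[of \<sigma>]]
      unfolding e .
    from DERIV_cmult[OF this, of "sqrt (2 * Vmin) * \<sigma> / alpha_star \<alpha>"]
    have "(?F has_real_derivative sqrt (2 * Vmin) * (\<sigma> * \<sigma>) * (\<sigma> * t) powr (- \<alpha> / 2)) (at t within {a..b})"
      using \<alpha> by (simp add: mult_ac)
    moreover have "\<sigma> * \<sigma> = 1" using \<sigma> by auto
    ultimately show "(?F has_vector_derivative ?f t) (at t within {a..b})"
      by (simp only: has_real_derivative_iff_has_vector_derivative mult_1_right)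
  qed (use \<open>a < b\<close> in simp)
  then have "integral {a..b} ?f = sqrt (2 * Vmin) * \<sigma> * ((\<sigma> * b) powr alpha_star \<alpha> - (\<sigma> * a) powr alpha_star \<alpha>) / alpha_star \<alpha>"
    by (simp add: has_integral_iff right_diff_distrib diff_divide_distrib)
  moreover have "integral {0..d} (\<lambda>s. lagrangian V \<alpha> (y s) (w s)) = integral {a..b} ?f"
    unfolding L[rule_format, OF i, THEN conjunct2] by (rule Henstock_Kurzweil_Integration.integral_cong) (rule eq)
  moreover have "0 \<notin> y ` {0..d}" unfolding Y(5) using pos \<xi>(1) by fastforce
  ultimately show ?thesis
    unfolding arc_action_def using Y by (intro exI[of _ 0] exI[of _ d] exI[of _ y] exI[of _ w]) simp
qed

text \<open>The shrunk arc is joined to the unit sphere by two radial motions. Each of them costs half of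
  the second term.\<close>

lemma arc_actions_shrink:
  fixes V :: "'a::euclidean_space \<Rightarrow> real"
  assumes V: "continuous_on (sphere 0 1) V" and "norm \<xi>m = 1" "norm \<xi>p = 1" "V \<xi>m = Vmin" "V \<xi>p = Vmin" "0 < Vmin"
    and \<alpha>: "0 < alpha_star \<alpha>" and l: "0 < l" "l < 1" and \<epsilon>: "0 < \<epsilon>" "\<epsilon> \<le> 1"
    and A: "A \<in> arc_actions \<xi>m \<xi>p V \<alpha> \<epsilon>"
  obtains A' where "A' \<le> l powr alpha_star \<alpha> * A + 2 / alpha_star \<alpha> * sqrt (2 * Vmin) * (1 - l powr alpha_star \<alpha>)"
    "A' \<in> arc_actions \<xi>m \<xi>p V \<alpha> (l * \<epsilon>)"
proof -
  obtain C where C: "arc_action V \<alpha> \<xi>m \<xi>p C A" "\<forall>y\<in>C. \<epsilon> \<le> norm y" "\<exists>y\<in>C. norm y = \<epsilon>"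
    using A unfolding arc_actions_def by blast
  obtain B where B: "B \<le> l powr alpha_star \<alpha> * A" "arc_action V \<alpha> (l *\<^sub>R \<xi>m) (l *\<^sub>R \<xi>p) ((*\<^sub>R) l ` C) B"
    using arc_action_scale[OF V l(1) C(1)] by blast
  define R where "R = sqrt (2 * Vmin) * (1 - l powr alpha_star \<alpha>) / alpha_star \<alpha>"
  have down: "arc_action V \<alpha> \<xi>m (l *\<^sub>R \<xi>m) ((\<lambda>t. (- t) *\<^sub>R \<xi>m) ` {- 1..- l}) R"
    using arc_action_radial[OF V assms(2,4,6) \<alpha>, of "- 1" "- l" "- 1"] l
    by (simp add: R_def minus_mult_right[symmetric] algebra_simps)
  have up: "arc_action V \<alpha> (l *\<^sub>R \<xi>p) \<xi>p ((\<lambda>t. t *\<^sub>R \<xi>p) ` {l..1}) R"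
    using arc_action_radial[OF V assms(3,5,6) \<alpha>, of l 1 1] l by (simp add: R_def)
  let ?C = "((\<lambda>t. (- t) *\<^sub>R \<xi>m) ` {- 1..- l} \<union> (*\<^sub>R) l ` C) \<union> (\<lambda>t. t *\<^sub>R \<xi>p) ` {l..1}"
  have "arc_action V \<alpha> \<xi>m \<xi>p ?C (R + B + R)"
    by (rule arc_action_join[OF V arc_action_join[OF V down B(2)] up])
  \<comment> \<open>The radial pieces stay at distance at least \<open>l\<close>; that this respects the constraint is where \<open>\<epsilon> \<le> 1\<close> enters.\<close>
  moreover have le: "l * \<epsilon> \<le> l" using l \<epsilon> by simp
  have "\<forall>y\<in>?C. l * \<epsilon> \<le> norm y"
    using C(2) l assms(2,3) by (auto simp: abs_if intro: order_trans[OF le])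
  moreover obtain z where "z \<in> C" "norm z = \<epsilon>" using C(3) by blast
  then have "\<exists>y\<in>?C. norm y = l * \<epsilon>" using l by (intro bexI[of _ "l *\<^sub>R z"]) auto
  ultimately have "R + B + R \<in> arc_actions \<xi>m \<xi>p V \<alpha> (l * \<epsilon>)" unfolding arc_actions_def by blast
  moreover have "R + B + R \<le> l powr alpha_star \<alpha> * A + 2 / alpha_star \<alpha> * sqrt (2 * Vmin) * (1 - l powr alpha_star \<alpha>)"
    using B(1) by (simp add: R_def field_simps)
  ultimately show ?thesis using that by blast
qed

section \<open>The cost of crossing the barrier\<close>

text \<open>Take the first time \<open>q\<close> in \<open>Fp\<close> and then the last time \<open>p\<close> before it in \<open>Fm\<close>. Both exist because the
  sets are closed, and in between the curve avoids both sets.\<close>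

lemma crossing_times:
  fixes u :: "real \<Rightarrow> 'a::euclidean_space"
  assumes u: "continuous_on {a..b} u" and sph: "\<And>t. t \<in> {a..b} \<Longrightarrow> u t \<in> sphere 0 1" and "a \<le> b"
    and Fm: "closed Fm" "u a \<in> Fm" and Fp: "closed Fp" "u b \<in> Fp" and disj: "Fm \<inter> Fp = {}"
    and cover: "sphere 0 1 - O' \<subseteq> Fm \<union> Fp"
  obtains p q where "a \<le> p" "p < q" "q \<le> b" "u p \<in> Fm" "u q \<in> Fp" "\<And>t. p < t \<Longrightarrow> t < q \<Longrightarrow> u t \<in> O'"
proof -
  have "compact ({a..b} \<inter> u -` Fp)"
    using continuous_closed_preimage[OF u closed_atLeastAtMost Fp(1)]
    by (simp add: compact_eq_bounded_closed bounded_Int)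
  moreover have "b \<in> {a..b} \<inter> u -` Fp" using Fp \<open>a \<le> b\<close> by auto
  ultimately obtain q where q: "q \<in> {a..b} \<inter> u -` Fp" "\<And>t. t \<in> {a..b} \<inter> u -` Fp \<Longrightarrow> q \<le> t"
    using compact_attains_inf[of "{a..b} \<inter> u -` Fp"] by blast
  have "continuous_on {a..q} u" using q(1) by (intro continuous_on_subset[OF u]) auto
  then have "compact ({a..q} \<inter> u -` Fm)"
    using continuous_closed_preimage[OF _ closed_atLeastAtMost Fm(1)]
    by (simp add: compact_eq_bounded_closed bounded_Int)
  moreover have "a \<in> {a..q} \<inter> u -` Fm" using Fm q(1) by auto
  ultimately obtain p where p: "p \<in> {a..q} \<inter> u -` Fm" "\<And>t. t \<in> {a..q} \<inter> u -` Fm \<Longrightarrow> t \<le> p"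
    using compact_attains_sup[of "{a..q} \<inter> u -` Fm"] by blast
  have "p \<noteq> q" using p(1) q(1) disj by blast
  show ?thesis
  proof (rule that[of p q])
    show "u t \<in> O'" if "p < t" "t < q" for t
    proof -
      have t: "t \<in> {a..b}" using that p(1) q(1) by auto
      have "u t \<notin> Fp" using q(2)[of t] t that by auto
      moreover have "u t \<notin> Fm" using p(2)[of t] t that by auto
      ultimately show ?thesis using sph[OF t] cover by blast
    qed
  qed (use p(1) q(1) \<open>p \<noteq> q\<close> in auto)
qed

lemma radial_power_derivative_direction:
  assumes "y \<noteq> 0"
  shows "radial_power_derivative (- 1) y h = (h - (h \<bullet> sgn y) *\<^sub>R sgn y) /\<^sub>R norm y"
proof -
  have r: "norm y > 0" using assms by simp
  have "norm y powr (- 1 - 2) = 1 / (norm y * norm y * norm y)"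
    using r powr_minus_divide[of "norm y" 3] by (simp add: power3_eq_cube)
  moreover have "norm y powr (- 1) = inverse (norm y)" using r by (simp add: powr_minus)
  ultimately show ?thesis
    using r by (simp add: radial_power_derivative_def sgn_div_norm inner_commute algebra_simps divide_inverse)
qed

text \<open>Split the velocity into radial and tangential parts and the potential into \<open>Vmin\<close> and the
  excess \<open>W\<close>, and apply the inequality of arithmetic and geometric means to each pair. In the
  tangential pair, \<open>|y| powr (- \<alpha> / 2) = |y| powr alpha_star \<alpha> / |y|\<close> is at least \<open>\<epsilon> powr alpha_star \<alpha> / |y|\<close>.\<close>

lemma lagrangian_lower_bound:
  fixes y h e :: "'a::euclidean_space"
  assumes "y \<noteq> 0" and V: "V (y /\<^sub>R norm y) \<ge> Vmin + W" and "0 \<le> Vmin" "0 \<le> W" and "norm e \<le> 1"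
    and \<epsilon>: "0 < \<epsilon>" "\<epsilon> \<le> norm y" and \<alpha>: "0 \<le> alpha_star \<alpha>"
  shows "sqrt (2 * Vmin) * (norm y powr (- \<alpha> / 2) * \<bar>sgn y \<bullet> h\<bar>)
     + sqrt (2 * W) * \<epsilon> powr alpha_star \<alpha> * (e \<bullet> radial_power_derivative (- 1) y h) \<le> lagrangian V \<alpha> y h"
proof -
  define r where "r = norm y"
  have r: "r > 0" using assms by (simp add: r_def)
  define z where "z = r powr (- \<alpha> / 2)"
  have z: "z > 0" "r powr \<alpha> = inverse (z * z)"
    using r by (auto simp: z_def powr_minus[symmetric] simp flip: powr_add)
  define s where "s = h \<bullet> sgn y"
  define \<tau> where "\<tau> = h - s *\<^sub>R sgn y"
  have n1: "sgn y \<bullet> sgn y = 1" using assms(1) by (simp add: dot_square_norm norm_sgn)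
  have orth: "\<tau> \<bullet> sgn y = 0" by (simp add: \<tau>_def s_def inner_diff_left n1)
  have "h = \<tau> + s *\<^sub>R sgn y" by (simp add: \<tau>_def)
  then have "h \<bullet> h = \<tau> \<bullet> \<tau> + s\<^sup>2"
    using orth n1 by (simp add: inner_add_left inner_add_right inner_commute power2_eq_square)
  then have hh: "(norm h)\<^sup>2 = (norm \<tau>)\<^sup>2 + s\<^sup>2" by (simp add: power2_norm_eq_inner)
  have "e \<bullet> radial_power_derivative (- 1) y h = (e \<bullet> \<tau>) / r"
    using radial_power_derivative_direction[OF assms(1), of h]
    by (simp add: \<tau>_def s_def r_def divide_inverse mult.commute)
  also have "\<dots> \<le> norm \<tau> / r"
  proof (rule divide_right_mono)
    have "e \<bullet> \<tau> \<le> norm e * norm \<tau>" by (rule norm_cauchy_schwarz)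
    also have "\<dots> \<le> 1 * norm \<tau>" using assms(5) by (intro mult_right_mono) auto
    finally show "e \<bullet> \<tau> \<le> norm \<tau>" by simp
  qed (use r in simp)
  finally have "\<epsilon> powr alpha_star \<alpha> * (e \<bullet> radial_power_derivative (- 1) y h) \<le> \<epsilon> powr alpha_star \<alpha> * (norm \<tau> / r)"
    by (intro mult_left_mono) auto
  also have "\<dots> \<le> r powr alpha_star \<alpha> * (norm \<tau> / r)"
    using \<epsilon> \<alpha> r by (intro mult_right_mono powr_mono2) (auto simp: r_def)
  also have "\<dots> = z * norm \<tau>"
  proof -
    have e: "alpha_star \<alpha> = - \<alpha> / 2 + 1" by (simp add: alpha_star_def field_simps)
    have "r powr alpha_star \<alpha> = z * r" using r unfolding e powr_add by (simp add: z_def)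
    then show ?thesis using r by simp
  qed
  finally have tang: "sqrt (2 * W) * (\<epsilon> powr alpha_star \<alpha> * (e \<bullet> radial_power_derivative (- 1) y h)) \<le> sqrt (2 * W) * (z * norm \<tau>)"
    using assms(4) by (intro mult_left_mono) auto
  have AMGM: "sqrt (2 * c) * (z * t) \<le> 1 / 2 * t\<^sup>2 + c * (z * z)" if "0 \<le> c" for c t
  proof -
    have "0 \<le> (t - sqrt (2 * c) * z)\<^sup>2" by simp
    also have "\<dots> = t\<^sup>2 + 2 * c * (z * z) - 2 * (sqrt (2 * c) * (z * t))"
      using that by (simp add: power2_diff power_mult_distrib) (simp add: power2_eq_square)
    finally show ?thesis by simp
  qed
  have "lagrangian V \<alpha> y h = 1 / 2 * ((norm \<tau>)\<^sup>2 + s\<^sup>2) + V (y /\<^sub>R norm y) * (z * z)"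
    unfolding lagrangian_def hh r_def[symmetric] z(2) using z(1) by (simp add: field_simps)
  also have "\<dots> \<ge> 1 / 2 * ((norm \<tau>)\<^sup>2 + s\<^sup>2) + (Vmin + W) * (z * z)"
    using V z(1) by (intro add_left_mono mult_right_mono) auto
  finally have "1 / 2 * (norm \<tau>)\<^sup>2 + W * (z * z) + (1 / 2 * s\<^sup>2 + Vmin * (z * z)) \<le> lagrangian V \<alpha> y h"
    by (simp add: algebra_simps)
  moreover have radial: "norm y powr (- \<alpha> / 2) * \<bar>sgn y \<bullet> h\<bar> = z * \<bar>s\<bar>"
    unfolding z_def r_def s_def inner_commute[of h] ..
  ultimately show ?thesis
    using AMGM[OF assms(4), of "norm \<tau>"] AMGM[OF assms(3), of "\<bar>s\<bar>"] tang
    unfolding radial power2_abs mult.assoc[of "sqrt (2 * W)"] by linarith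
qed

text \<open>The function \<open>|x| powr alpha_star \<alpha> / alpha_star \<alpha>\<close> has to come down from its value on the
  unit sphere to its value at distance \<open>\<epsilon>\<close>, and to return.\<close>

lemma radial_variation_ge:
  fixes x :: "real \<Rightarrow> 'a::euclidean_space"
  assumes x: "energy_curve a b x v" and x0: "0 \<notin> x ` {a..b}" and ends: "norm (x a) = 1" "norm (x b) = 1"
    and c: "c \<in> {a..b}" "norm (x c) = \<epsilon>" and \<alpha>: "0 < alpha_star \<alpha>"
  shows "(\<lambda>t. norm (x t) powr (- \<alpha> / 2) * \<bar>sgn (x t) \<bullet> v t\<bar>) integrable_on {a..b}"
    and "2 * (1 - \<epsilon> powr alpha_star \<alpha>) / alpha_star \<alpha> \<le> integral {a..b} (\<lambda>t. norm (x t) powr (- \<alpha> / 2) * \<bar>sgn (x t) \<bullet> v t\<bar>)"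
proof -
  let ?g = "\<lambda>t. norm (x t) powr (- \<alpha> / 2) * (sgn (x t) \<bullet> v t)"
  let ?G = "\<lambda>y::'a. norm y powr alpha_star \<alpha> / alpha_star \<alpha>"
  have xn: "x t \<noteq> 0" if "t \<in> {a..b}" for t using x0 that by force
  have P: "primitive_on a b (\<lambda>t. ?G (x t)) ?g"
  proof (rule primitive_on_chain_rule[OF energy_curveD(1)[OF x], where D = "\<lambda>t h. norm (x t) powr (- \<alpha> / 2) * (sgn (x t) \<bullet> h)"])
    fix t assume t: "t \<in> {a..b}"
    have r: "norm (x t) > 0" using xn[OF t] by simp
    have e: "alpha_star \<alpha> - 2 + 1 = - \<alpha> / 2" by (simp add: alpha_star_def field_simps)
    define P where "P = norm (x t) powr (alpha_star \<alpha> - 2)"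
    have p: "norm (x t) powr (- \<alpha> / 2) = P * norm (x t)"
      using r powr_add[of "norm (x t)" "alpha_star \<alpha> - 2" 1] unfolding e P_def by simp
    have "alpha_star \<alpha> * P * (x t \<bullet> h) * inverse (alpha_star \<alpha>) = P * norm (x t) * (sgn (x t) \<bullet> h)" for h
      using r \<alpha> by (simp add: sgn_div_norm)
    then have "(\<lambda>h. alpha_star \<alpha> * P * (x t \<bullet> h) * inverse (alpha_star \<alpha>)) = (\<lambda>h. norm (x t) powr (- \<alpha> / 2) * (sgn (x t) \<bullet> h))"
      unfolding p by blast
    then show "(?G has_derivative (\<lambda>h. norm (x t) powr (- \<alpha> / 2) * (sgn (x t) \<bullet> h))) (at (x t))"
      using has_derivative_mult_left[OF has_derivative_norm_powr[OF xn[OF t], of "alpha_star \<alpha>"], of "inverse (alpha_star \<alpha>)"]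
      unfolding P_def[symmetric] divide_inverse by metis
  next
    show "continuous_on {a..b} (\<lambda>t. norm (x t) powr (- \<alpha> / 2) * (sgn (x t) \<bullet> h))" for h
      using xn by (intro continuous_intros energy_curveD(4)[OF x]) auto
  qed
  have ig: "?g absolutely_integrable_on {a..b}" using P unfolding primitive_on_def by blast
  have eq: "norm (?g t) = norm (x t) powr (- \<alpha> / 2) * \<bar>sgn (x t) \<bullet> v t\<bar>" for t by (simp add: abs_mult)
  have ia: "(\<lambda>t. norm (?g t)) integrable_on {a..b}" using ig unfolding absolutely_integrable_on_def by blast
  then show "(\<lambda>t. norm (x t) powr (- \<alpha> / 2) * \<bar>sgn (x t) \<bullet> v t\<bar>) integrable_on {a..b}" unfolding eq .
  have piece: "\<bar>?G (x q) - ?G (x p)\<bar> \<le> integral {p..q} (\<lambda>t. norm (?g t))" if "a \<le> p" "p \<le> q" "q \<le> b" for p q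
  proof -
    have "?g absolutely_integrable_on {p..q}"
      using absolutely_integrable_on_subinterval[OF ig, of p q] that by auto
    then have "norm (integral {p..q} ?g) \<le> integral {p..q} (\<lambda>t. norm (?g t))"
      unfolding absolutely_integrable_on_def by (intro integral_norm_bound_integral) auto
    then show ?thesis using primitive_on_increment[OF P that] by simp
  qed
  have "(1 - \<epsilon> powr alpha_star \<alpha>) / alpha_star \<alpha> \<le> integral {a..c} (\<lambda>t. norm (?g t))"
    using piece[of a c] c ends by (simp add: diff_divide_distrib)
  moreover have "(1 - \<epsilon> powr alpha_star \<alpha>) / alpha_star \<alpha> \<le> integral {c..b} (\<lambda>t. norm (?g t))"
    using piece[of c b] c ends by (simp add: diff_divide_distrib)
  moreover have "integral {a..c} (\<lambda>t. norm (?g t)) + integral {c..b} (\<lambda>t. norm (?g t)) = integral {a..b} (\<lambda>t. norm (?g t))"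
    by (rule Henstock_Kurzweil_Integration.integral_combine) (use c ia in auto)
  moreover have "2 * (1 - \<epsilon> powr alpha_star \<alpha>) / alpha_star \<alpha> = (1 - \<epsilon> powr alpha_star \<alpha>) / alpha_star \<alpha> + (1 - \<epsilon> powr alpha_star \<alpha>) / alpha_star \<alpha>"
    by simp
  ultimately show "2 * (1 - \<epsilon> powr alpha_star \<alpha>) / alpha_star \<alpha> \<le> integral {a..b} (\<lambda>t. norm (x t) powr (- \<alpha> / 2) * \<bar>sgn (x t) \<bullet> v t\<bar>)"
    unfolding eq[symmetric] by linarith
qed

text \<open>The radial terms account for \<open>(2 / alpha_star \<alpha>) * sqrt (2 * Vmin) * (1 - \<epsilon> powr alpha_star \<alpha>)\<close>. During the passage
  through the barrier \<open>O'\<close>, the component of the direction \<open>x / |x|\<close> along the chord between its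
  end values grows by the length of that chord, which is at least \<open>setdist Fm Fp\<close>.\<close>

lemma arc_actions_lower_bound:
  fixes V :: "'a::euclidean_space \<Rightarrow> real"
  assumes V: "continuous_on (sphere 0 1) V" and Vmin: "\<forall>s\<in>sphere 0 1. Vmin \<le> V s" "0 < Vmin"
    and \<xi>: "\<xi>m \<in> sphere 0 1" "\<xi>p \<in> sphere 0 1" and F: "closed Fm" "\<xi>m \<in> Fm" "closed Fp" "\<xi>p \<in> Fp" "Fm \<inter> Fp = {}"
    and cover: "sphere 0 1 - O' \<subseteq> Fm \<union> Fp" and W: "\<forall>s\<in>O'. Vmin + W \<le> V s" "0 \<le> W"
    and \<alpha>: "0 < alpha_star \<alpha>" and "0 < \<epsilon>" and A: "A \<in> arc_actions \<xi>m \<xi>p V \<alpha> \<epsilon>"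
  shows "2 / alpha_star \<alpha> * sqrt (2 * Vmin)
     + \<epsilon> powr alpha_star \<alpha> * (sqrt (2 * W) * setdist Fm Fp - 2 / alpha_star \<alpha> * sqrt (2 * Vmin)) \<le> A"
proof -
  obtain a b x v where ab: "a < b" and x: "energy_curve a b x v" and ends: "x a = \<xi>m" "x b = \<xi>p"
    and A: "integral {a..b} (\<lambda>t. lagrangian V \<alpha> (x t) (v t)) = A" and x0: "0 \<notin> x ` {a..b}"
    and ge: "\<And>t. t \<in> {a..b} \<Longrightarrow> \<epsilon> \<le> norm (x t)" and ex: "\<exists>c\<in>{a..b}. norm (x c) = \<epsilon>"
    using A unfolding arc_actions_def arc_action_def by blast
  obtain c where c: "c \<in> {a..b}" "norm (x c) = \<epsilon>" using ex by blast
  have xn: "x t \<noteq> 0" if "t \<in> {a..b}" for t using x0 that by force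
  let ?u = "\<lambda>t. radial_power (- 1) (x t)" and ?u' = "\<lambda>t. radial_power_derivative (- 1) (x t) (v t)"
  have dir: "radial_power (- 1) y = y /\<^sub>R norm y" for y :: 'a
    by (cases "y = 0") (auto simp: radial_power_def powr_minus)
  have U: "primitive_on a b ?u ?u'"
    using xn energy_curveD(4)[OF x]
    by (intro primitive_on_chain_rule[OF energy_curveD(1)[OF x] has_derivative_radial_power]
        continuous_on_compose2[OF continuous_on_radial_power_derivative]) auto
  have usph: "?u t \<in> sphere 0 1" if "t \<in> {a..b}" for t using xn[OF that] by (simp add: dir)
  have uend: "?u a = \<xi>m" "?u b = \<xi>p" using ends \<xi> by (auto simp: dir)
  obtain p q where pq: "a \<le> p" "p < q" "q \<le> b" "?u p \<in> Fm" "?u q \<in> Fp" "\<And>t. p < t \<Longrightarrow> t < q \<Longrightarrow> ?u t \<in> O'"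
  proof (rule crossing_times[OF primitive_on_continuous[OF U] usph less_imp_le[OF ab] F(1) _ F(3) _ F(5) cover])
    show "?u a \<in> Fm" "?u b \<in> Fp" unfolding uend using F(2,4) by blast+
  qed blast+
  define e where "e = sgn (?u q - ?u p)"
  let ?t = "\<lambda>t. e \<bullet> ?u' t"
  have iu: "?u' absolutely_integrable_on {p..q}"
  proof (rule absolutely_integrable_on_subinterval)
    show "?u' absolutely_integrable_on {a..b}" using U unfolding primitive_on_def by blast
    show "{p..q} \<subseteq> {a..b}" using pq(1,3) by auto
  qed
  then have iu': "?u' integrable_on {p..q}" unfolding absolutely_integrable_on_def by blast
  have it: "?t integrable_on {p..q}"
    using integrable_linear[OF iu' bounded_linear_inner_right[of e]] by (simp add: o_def)
  have "integral {p..q} ?t = e \<bullet> (?u q - ?u p)"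
    using integral_linear[OF iu' bounded_linear_inner_right[of e]] primitive_on_increment[OF U pq(1) less_imp_le[OF pq(2)] pq(3)]
    by (simp add: o_def)
  also have "\<dots> = norm (?u q - ?u p)"
    by (cases "?u q = ?u p") (simp_all add: e_def sgn_div_norm dot_square_norm power2_eq_square)
  also have "\<dots> \<ge> setdist Fm Fp"
    using setdist_le_dist[OF pq(4,5)] by (simp add: dist_norm norm_minus_commute)
  finally have T: "setdist Fm Fp \<le> integral {p..q} ?t" .
  let ?k = "sqrt (2 * W) * \<epsilon> powr alpha_star \<alpha>"
  let ?s = "\<lambda>t. if t \<in> {p<..<q} then ?k * ?t t else 0"
  let ?r = "\<lambda>t. norm (x t) powr (- \<alpha> / 2) * \<bar>sgn (x t) \<bullet> v t\<bar>"
  note R = radial_variation_ge[OF x x0 _ _ c \<alpha>]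
  have n1: "norm (x a) = 1" "norm (x b) = 1" using ends \<xi> by auto
  have s1: "(\<lambda>t. ?k * ?t t) integrable_on {p<..<q}"
    using it by (intro integrable_on_mult_right) (simp add: integrable_on_Icc_iff_Ioo)
  have sub: "{p<..<q} \<inter> {a..b} = {p<..<q}" using pq by auto
  have si: "?s integrable_on {a..b}"
    using s1 integrable_restrict_Int[of "{p<..<q}" "\<lambda>t. ?k * ?t t" "{a..b}"] sub by simp
  have "integral {a..b} ?s = integral {p<..<q} (\<lambda>t. ?k * ?t t)"
    using integral_restrict_Int[of "{a..b}" "{p<..<q}" "\<lambda>t. ?k * ?t t"] sub by simp
  also have "\<dots> = ?k * integral {p..q} ?t"
    by (simp add: integral_open_interval_real)
  also have "\<dots> \<ge> ?k * setdist Fm Fp" using T W(2) by (intro mult_left_mono) auto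
  finally have S: "?k * setdist Fm Fp \<le> integral {a..b} ?s" .
  have il: "(\<lambda>t. lagrangian V \<alpha> (x t) (v t)) integrable_on {a..b}"
    using lagrangian_integrable[OF V x x0] unfolding absolutely_integrable_on_def by blast
  have ir: "(\<lambda>t. sqrt (2 * Vmin) * ?r t) integrable_on {a..b}"
    by (rule integrable_on_mult_right[OF R(1)[OF n1]])
  have "integral {a..b} (\<lambda>t. sqrt (2 * Vmin) * ?r t + ?s t) \<le> A"
    unfolding A[symmetric]
  proof (rule integral_le[OF Henstock_Kurzweil_Integration.integrable_add[OF ir si] il])
    fix t assume t: "t \<in> {a..b}"
    have Vt: "Vmin \<le> V (x t /\<^sub>R norm (x t))" using usph[OF t] Vmin(1) by (simp add: dir)
    have ne: "norm e \<le> 1" by (simp add: e_def norm_sgn)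
    show "sqrt (2 * Vmin) * ?r t + ?s t \<le> lagrangian V \<alpha> (x t) (v t)"
    proof (cases "t \<in> {p<..<q}")
      case True
      then have "Vmin + W \<le> V (x t /\<^sub>R norm (x t))" using pq(6)[of t] W(1) by (simp add: dir)
      from lagrangian_lower_bound[where V = V and y = "x t", OF xn[OF t] this _ W(2) ne \<open>0 < \<epsilon>\<close> ge[OF t], of \<alpha> "v t"]
      show ?thesis unfolding if_P[OF True] using Vmin(2) \<alpha> by simp
    next
      case False
      from lagrangian_lower_bound[OF xn[OF t], of Vmin 0 V e \<epsilon> \<alpha> "v t"]
      show ?thesis unfolding if_not_P[OF False] using Vmin(2) Vt ne \<open>0 < \<epsilon>\<close> ge[OF t] \<alpha> by simp
    qed
  qed
  moreover have "integral {a..b} (\<lambda>t. sqrt (2 * Vmin) * ?r t + ?s t) = sqrt (2 * Vmin) * integral {a..b} ?r + integral {a..b} ?s"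
    using Henstock_Kurzweil_Integration.integral_add[OF ir si] by simp
  moreover have "sqrt (2 * Vmin) * (2 * (1 - \<epsilon> powr alpha_star \<alpha>) / alpha_star \<alpha>) \<le> sqrt (2 * Vmin) * integral {a..b} ?r"
    using R(2)[OF n1] Vmin(2) by (intro mult_left_mono) auto
  ultimately have "sqrt (2 * Vmin) * (2 * (1 - \<epsilon> powr alpha_star \<alpha>) / alpha_star \<alpha>) + ?k * setdist Fm Fp \<le> A"
    using S by linarith
  also have "sqrt (2 * Vmin) * (2 * (1 - \<epsilon> powr alpha_star \<alpha>) / alpha_star \<alpha>) + ?k * setdist Fm Fp
      = 2 / alpha_star \<alpha> * sqrt (2 * Vmin)
        + \<epsilon> powr alpha_star \<alpha> * (sqrt (2 * W) * setdist Fm Fp - 2 / alpha_star \<alpha> * sqrt (2 * Vmin))"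
    by (simp add: algebra_simps diff_divide_distrib)
  finally show ?thesis .
qed

section \<open>The two limits\<close>

lemma tendsto_at_right_mono_ereal:
  fixes f :: "real \<Rightarrow> ereal"
  assumes "0 < c" and mono: "\<And>s t. 0 < s \<Longrightarrow> s \<le> t \<Longrightarrow> t \<le> c \<Longrightarrow> f s \<le> f t"
  shows "(f \<longlongrightarrow> (INF t\<in>{0<..c}. f t)) (at_right 0)"
proof (rule order_tendstoI)
  fix l assume l: "l < (INF t\<in>{0<..c}. f t)"
  have "l < f t" if "t \<in> {0<..c}" for t using l INF_lower[OF that, of f] by (rule less_le_trans)
  then show "\<forall>\<^sub>F t in at_right 0. l < f t"
    using \<open>0 < c\<close> by (auto simp: eventually_at_right intro!: exI[of _ c])
next
  fix u assume "(INF t\<in>{0<..c}. f t) < u"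
  then obtain t where t: "0 < t" "t \<le> c" "f t < u" by (auto simp: INF_less_iff)
  have "f s < u" if "0 < s" "s < t" for s using mono[of s t] that t by (auto intro: le_less_trans)
  then show "\<forall>\<^sub>F t in at_right 0. f t < u"
    using t(1) by (auto simp: eventually_at_right intro!: exI[of _ t])
qed

lemma tendsto_at_right_antimono_ereal:
  fixes f :: "real \<Rightarrow> ereal"
  assumes "0 < c" and mono: "\<And>s t. 0 < s \<Longrightarrow> s \<le> t \<Longrightarrow> t \<le> c \<Longrightarrow> f t \<le> f s"
  shows "(f \<longlongrightarrow> (SUP t\<in>{0<..c}. f t)) (at_right 0)"
proof (rule order_tendstoI)
  fix u assume u: "(SUP t\<in>{0<..c}. f t) < u"
  have "f t < u" if "t \<in> {0<..c}" for t using SUP_upper[OF that, of f] u by (rule le_less_trans)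
  then show "\<forall>\<^sub>F t in at_right 0. f t < u"
    using \<open>0 < c\<close> by (auto simp: eventually_at_right intro!: exI[of _ c])
next
  fix l assume "l < (SUP t\<in>{0<..c}. f t)"
  then obtain t where t: "0 < t" "t \<le> c" "l < f t" by (auto simp: less_SUP_iff)
  have "l < f s" if "0 < s" "s < t" for s using mono[of s t] that t by (auto intro: less_le_trans)
  then show "\<forall>\<^sub>F t in at_right 0. l < f t"
    using t(1) by (auto simp: eventually_at_right intro!: exI[of _ t])
qed

locale minimal_sphere_potential =
  fixes \<xi>m \<xi>p :: "'a::euclidean_space" and Vmin :: real and V :: "'a \<Rightarrow> real"
  assumes V: "continuous_on (sphere 0 1) V" and Vge: "\<forall>s\<in>sphere 0 1. Vmin \<le> V s" and Vmin: "0 < Vmin"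
    and \<xi>: "norm \<xi>m = 1" "norm \<xi>p = 1" "V \<xi>m = Vmin" "V \<xi>p = Vmin"
begin

lemma V_nonneg: "\<forall>s\<in>sphere 0 1. 0 \<le> V s"
  using Vge Vmin by fastforce

text \<open>Shrinking an arc with constraint \<open>\<epsilon>2\<close> gives one with constraint \<open>\<epsilon>1\<close>, and the normalization of \<open>gam\<close> absorbs
  both the factor of the homothety and the cost of the two radial motions.\<close>

lemma gam_mono:
  assumes \<alpha>: "0 < alpha_star \<alpha>" and \<epsilon>: "0 < \<epsilon>1" "\<epsilon>1 \<le> \<epsilon>2" "\<epsilon>2 \<le> 1"
  shows "gam \<xi>m \<xi>p Vmin V \<alpha> \<epsilon>1 \<le> gam \<xi>m \<xi>p Vmin V \<alpha> \<epsilon>2"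
proof (cases "\<epsilon>1 = \<epsilon>2")
  case False
  define l where "l = \<epsilon>1 / \<epsilon>2"
  have l: "0 < l" "l < 1" "l * \<epsilon>2 = \<epsilon>1" using \<epsilon> False by (auto simp: l_def)
  define m where "m = 2 / alpha_star \<alpha> * sqrt (2 * Vmin)"
  have "0 < \<epsilon>2" using \<epsilon> by simp
  show ?thesis
    unfolding gam_eq_INF[OF V V_nonneg \<open>0 < \<epsilon>1\<close>] gam_eq_INF[OF V V_nonneg \<open>0 < \<epsilon>2\<close>] m_def[symmetric]
  proof (rule INF_mono)
    fix A assume "A \<in> arc_actions \<xi>m \<xi>p V \<alpha> \<epsilon>2"
    from arc_actions_shrink[OF V \<xi> Vmin \<alpha> l(1,2) \<open>0 < \<epsilon>2\<close> \<epsilon>(3) this]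
    obtain A' where A': "A' \<le> l powr alpha_star \<alpha> * A + m * (1 - l powr alpha_star \<alpha>)"
      "A' \<in> arc_actions \<xi>m \<xi>p V \<alpha> \<epsilon>1"
      unfolding l(3) m_def by blast
    have e: "\<epsilon>1 powr alpha_star \<alpha> = l powr alpha_star \<alpha> * \<epsilon>2 powr alpha_star \<alpha>"
      using l \<open>0 < \<epsilon>2\<close> by (simp add: powr_mult flip: l(3))
    have "A' - m \<le> l powr alpha_star \<alpha> * (A - m)" using A'(1) by (simp add: algebra_simps)
    then have "(A' - m) / \<epsilon>1 powr alpha_star \<alpha> \<le> l powr alpha_star \<alpha> * (A - m) / \<epsilon>1 powr alpha_star \<alpha>"
      by (intro divide_right_mono) auto
    also have "\<dots> = (A - m) / \<epsilon>2 powr alpha_star \<alpha>" unfolding e using l by simp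
    finally show "\<exists>A'\<in>arc_actions \<xi>m \<xi>p V \<alpha> \<epsilon>1. ereal ((A' - m) / \<epsilon>1 powr alpha_star \<alpha>) \<le> ereal ((A - m) / \<epsilon>2 powr alpha_star \<alpha>)"
      using A'(2) by auto
  qed
qed simp

lemma gam_eps0_eq_INF:
  assumes "0 < alpha_star \<alpha>"
  shows "gam_eps0 \<xi>m \<xi>p Vmin V \<alpha> = (INF \<epsilon>\<in>{0<..1}. gam \<xi>m \<xi>p Vmin V \<alpha> \<epsilon>)"
  unfolding gam_eps0_def
  by (intro tendsto_Lim tendsto_at_right_mono_ereal gam_mono assms) auto

text \<open>The radial power sends distance \<open>\<epsilon>\<close> to \<open>\<epsilon> powr b\<close>, and \<open>(\<epsilon> powr b) powr alpha_star \<alpha>2\<close> is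
  \<open>\<epsilon> powr alpha_star \<alpha>1\<close>; the collision levels differ by the same factor \<open>b\<close> as the actions.\<close>

lemma gam_change_exponent:
  assumes \<alpha>: "0 < alpha_star \<alpha>2" "1 \<le> b" "b * alpha_star \<alpha>2 = alpha_star \<alpha>1" and "0 < \<epsilon>"
  shows "gam \<xi>m \<xi>p Vmin V \<alpha>2 (\<epsilon> powr b) \<le> ereal b * gam \<xi>m \<xi>p Vmin V \<alpha>1 \<epsilon>"
proof -
  have p: "0 < \<epsilon> powr b" using \<open>0 < \<epsilon>\<close> by simp
  have \<alpha>1: "0 < alpha_star \<alpha>1" using \<alpha> by (simp flip: \<alpha>(3))
  define m where "m \<alpha> = 2 / alpha_star \<alpha> * sqrt (2 * Vmin)" for \<alpha>
  have m: "m \<alpha>2 = b * m \<alpha>1" using \<alpha> by (simp add: m_def flip: \<alpha>(3))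
  have "ereal (1 / b) * gam \<xi>m \<xi>p Vmin V \<alpha>2 (\<epsilon> powr b) \<le> gam \<xi>m \<xi>p Vmin V \<alpha>1 \<epsilon>"
    unfolding gam_eq_INF[OF V V_nonneg \<open>0 < \<epsilon>\<close>, of \<xi>m \<xi>p Vmin \<alpha>1] m_def[symmetric]
  proof (rule INF_greatest)
    fix A assume "A \<in> arc_actions \<xi>m \<xi>p V \<alpha>1 \<epsilon>"
    from arc_actions_radial_power[OF V \<xi>(1,2) \<open>0 < \<epsilon>\<close> \<alpha>(2,3) this]
    obtain A' where A': "A' \<le> b * A" "A' \<in> arc_actions \<xi>m \<xi>p V \<alpha>2 (\<epsilon> powr b)" by blast
    have "gam \<xi>m \<xi>p Vmin V \<alpha>2 (\<epsilon> powr b) \<le> ereal ((A' - m \<alpha>2) / (\<epsilon> powr b) powr alpha_star \<alpha>2)"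
      unfolding gam_eq_INF[OF V V_nonneg p] m_def by (rule INF_lower[OF A'(2)])
    also have "(A' - m \<alpha>2) / (\<epsilon> powr b) powr alpha_star \<alpha>2 \<le> b * ((A - m \<alpha>1) / \<epsilon> powr alpha_star \<alpha>1)"
    proof -
      have "A' - m \<alpha>2 \<le> b * (A - m \<alpha>1)" using A'(1) by (simp add: m algebra_simps)
      then have "(A' - m \<alpha>2) / \<epsilon> powr alpha_star \<alpha>1 \<le> b * (A - m \<alpha>1) / \<epsilon> powr alpha_star \<alpha>1"
        by (intro divide_right_mono) auto
      then show ?thesis by (simp add: powr_powr \<alpha>(3))
    qed
    finally show "ereal (1 / b) * gam \<xi>m \<xi>p Vmin V \<alpha>2 (\<epsilon> powr b) \<le> ereal ((A - m \<alpha>1) / \<epsilon> powr alpha_star \<alpha>1)"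
      using \<alpha>(2) by (cases "gam \<xi>m \<xi>p Vmin V \<alpha>2 (\<epsilon> powr b)") (auto simp: field_simps)
  qed
  then show ?thesis
    using \<alpha>(2)
    by (cases "gam \<xi>m \<xi>p Vmin V \<alpha>2 (\<epsilon> powr b)"; cases "gam \<xi>m \<xi>p Vmin V \<alpha>1 \<epsilon>") (auto simp: field_simps)
qed

text \<open>The factor \<open>b\<close> of the previous lemma is the quotient \<open>alpha_star \<alpha>1 / alpha_star \<alpha>2\<close>, so the weight
  \<open>alpha_star\<close> removes it.\<close>

lemma alpha_star_gam_eps0_antimono:
  assumes "\<alpha>1 \<le> \<alpha>2" "\<alpha>2 < 2"
  shows "ereal (alpha_star \<alpha>2) * gam_eps0 \<xi>m \<xi>p Vmin V \<alpha>2 \<le> ereal (alpha_star \<alpha>1) * gam_eps0 \<xi>m \<xi>p Vmin V \<alpha>1"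
proof -
  have s: "0 < alpha_star \<alpha>2" "alpha_star \<alpha>2 \<le> alpha_star \<alpha>1" using assms by (auto simp: alpha_star_def)
  then have s1: "0 < alpha_star \<alpha>1" by simp
  define b where "b = alpha_star \<alpha>1 / alpha_star \<alpha>2"
  have b: "1 \<le> b" "b * alpha_star \<alpha>2 = alpha_star \<alpha>1" using s by (auto simp: b_def)
  let ?g2 = "gam_eps0 \<xi>m \<xi>p Vmin V \<alpha>2"
  have "ereal (1 / b) * ?g2 \<le> gam_eps0 \<xi>m \<xi>p Vmin V \<alpha>1"
    unfolding gam_eps0_eq_INF[OF s1]
  proof (rule INF_greatest)
    fix \<epsilon> :: real assume \<epsilon>: "\<epsilon> \<in> {0<..1}"
    have "\<epsilon> powr b \<le> 1" using \<epsilon> b(1) powr_mono2[of b \<epsilon> 1] by simp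
    then have "?g2 \<le> gam \<xi>m \<xi>p Vmin V \<alpha>2 (\<epsilon> powr b)"
      unfolding gam_eps0_eq_INF[OF s(1)] using \<epsilon> by (intro INF_lower) auto
    also have "\<dots> \<le> ereal b * gam \<xi>m \<xi>p Vmin V \<alpha>1 \<epsilon>"
      by (rule gam_change_exponent[OF s(1) b]) (use \<epsilon> in auto)
    finally show "ereal (1 / b) * ?g2 \<le> gam \<xi>m \<xi>p Vmin V \<alpha>1 \<epsilon>"
      using b(1) by (cases ?g2; cases "gam \<xi>m \<xi>p Vmin V \<alpha>1 \<epsilon>") (auto simp: field_simps)
  qed
  then show ?thesis
    using s s1
    by (cases ?g2; cases "gam_eps0 \<xi>m \<xi>p Vmin V \<alpha>1") (auto simp: field_simps b_def)
qed

text \<open>The weighted function is monotone, hence has a one-sided limit, and the weight \<open>alpha_star \<alpha>\<close> tends to \<open>1\<close>.\<close>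

lemma gam_alpha0_eq_SUP:
  assumes "0 < c" "c < 2"
  shows "gam_alpha0 \<xi>m \<xi>p Vmin V = (SUP \<alpha>\<in>{0<..c}. ereal (alpha_star \<alpha>) * gam_eps0 \<xi>m \<xi>p Vmin V \<alpha>)"
proof -
  let ?h = "\<lambda>\<alpha>. ereal (alpha_star \<alpha>) * gam_eps0 \<xi>m \<xi>p Vmin V \<alpha>"
  have h: "(?h \<longlongrightarrow> (SUP \<alpha>\<in>{0<..c}. ?h \<alpha>)) (at_right 0)"
    using assms by (intro tendsto_at_right_antimono_ereal alpha_star_gam_eps0_antimono) auto
  have "((\<lambda>\<alpha>. inverse (alpha_star \<alpha>)) \<longlongrightarrow> inverse (alpha_star 0)) (at_right 0)"
    unfolding alpha_star_def by (intro tendsto_intros) auto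
  then have "((\<lambda>\<alpha>. ereal (inverse (alpha_star \<alpha>))) \<longlongrightarrow> ereal 1) (at_right 0)"
    by (simp add: alpha_star_def)
  from tendsto_mult_ereal[OF this h]
  have "((\<lambda>\<alpha>. ereal (inverse (alpha_star \<alpha>)) * ?h \<alpha>) \<longlongrightarrow> (SUP \<alpha>\<in>{0<..c}. ?h \<alpha>)) (at_right 0)"
    by (simp flip: one_ereal_def)
  moreover have "\<forall>\<^sub>F \<alpha> in at_right 0. ereal (inverse (alpha_star \<alpha>)) * ?h \<alpha> = gam_eps0 \<xi>m \<xi>p Vmin V \<alpha>"
  proof -
    have "ereal (inverse (alpha_star \<alpha>)) * ?h \<alpha> = gam_eps0 \<xi>m \<xi>p Vmin V \<alpha>" if "0 < \<alpha>" "\<alpha> < 1" for \<alpha>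
    proof -
      have "alpha_star \<alpha> > 0" using that by (simp add: alpha_star_def)
      then show ?thesis by (cases "gam_eps0 \<xi>m \<xi>p Vmin V \<alpha>") auto
    qed
    then show ?thesis by (intro eventually_at_rightI[of 0 1]) simp_all
  qed
  ultimately have "((\<lambda>\<alpha>. gam_eps0 \<xi>m \<xi>p Vmin V \<alpha>) \<longlongrightarrow> (SUP \<alpha>\<in>{0<..c}. ?h \<alpha>)) (at_right 0)"
    by (rule Lim_transform_eventually)
  then show ?thesis unfolding gam_alpha0_def by (intro tendsto_Lim) auto
qed

lemma gam_eps0_ge:
  assumes \<alpha>: "0 < alpha_star \<alpha>"
    and F: "closed Fm" "\<xi>m \<in> Fm" "closed Fp" "\<xi>p \<in> Fp" "Fm \<inter> Fp = {}"
    and cover: "sphere 0 1 - O' \<subseteq> Fm \<union> Fp" and W: "\<forall>s\<in>O'. Vmin + W \<le> V s" "0 \<le> W"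
  shows "ereal (sqrt (2 * W) * setdist Fm Fp - 2 / alpha_star \<alpha> * sqrt (2 * Vmin)) \<le> gam_eps0 \<xi>m \<xi>p Vmin V \<alpha>"
  unfolding gam_eps0_eq_INF[OF \<alpha>]
proof (rule INF_greatest)
  fix \<epsilon> :: real assume "\<epsilon> \<in> {0<..1}"
  then have \<epsilon>: "0 < \<epsilon>" by simp
  show "ereal (sqrt (2 * W) * setdist Fm Fp - 2 / alpha_star \<alpha> * sqrt (2 * Vmin)) \<le> gam \<xi>m \<xi>p Vmin V \<alpha> \<epsilon>"
    unfolding gam_eq_INF[OF V V_nonneg \<epsilon>]
  proof (rule INF_greatest)
    fix A assume A: "A \<in> arc_actions \<xi>m \<xi>p V \<alpha> \<epsilon>"
    have "\<xi>m \<in> sphere 0 1" "\<xi>p \<in> sphere 0 1" using \<xi> by auto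
    from arc_actions_lower_bound[OF V Vge Vmin this F cover W \<alpha> \<epsilon> A]
    have "\<epsilon> powr alpha_star \<alpha> * (sqrt (2 * W) * setdist Fm Fp - 2 / alpha_star \<alpha> * sqrt (2 * Vmin))
        \<le> A - 2 / alpha_star \<alpha> * sqrt (2 * Vmin)" by linarith
    moreover have "0 < \<epsilon> powr alpha_star \<alpha>" using \<epsilon> by simp
    ultimately show "ereal (sqrt (2 * W) * setdist Fm Fp - 2 / alpha_star \<alpha> * sqrt (2 * Vmin))
        \<le> ereal ((A - 2 / alpha_star \<alpha> * sqrt (2 * Vmin)) / \<epsilon> powr alpha_star \<alpha>)"
      unfolding ereal_less_eq by (simp only: pos_le_divide_eq mult.commute)
  qed
qed

end

lemma continuous_on_C2_sphere:
  assumes "C2_sphere V"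
  shows "continuous_on (sphere 0 1) V"
proof -
  obtain U f f' where U: "sphere 0 1 \<subseteq> U" "\<And>s. s \<in> sphere 0 1 \<Longrightarrow> f s = V s"
    and f: "\<And>x. x \<in> U \<Longrightarrow> (f has_derivative blinfun_apply (f' x)) (at x)"
    using assms unfolding C2_sphere_def C2_on_def by blast
  have "continuous_on (sphere 0 1) f"
    using U(1) f by (intro continuous_at_imp_continuous_on ballI has_derivative_continuous) blast
  then show ?thesis by (rule continuous_on_eq) (rule U(2))
qed

theorem lemma6p11:
  fixes \<xi>m \<xi>p :: "'a::euclidean_space" and Vmin :: real and V :: "'a \<Rightarrow> real"
    and O' Fm Fp :: "'a set"
  assumes "2 \<le> DIM('a)"
    and "\<xi>m \<in> sphere 0 1" and "\<xi>p \<in> sphere 0 1" and "\<xi>p \<noteq> \<xi>m" and "0 < Vmin"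
    and "V \<in> S_class \<xi>m \<xi>p Vmin"
    and "openin (top_of_set (sphere 0 1)) O'"
    and "components (sphere 0 1 - O') = {Fm, Fp}" and "Fm \<noteq> Fp"
    and "\<xi>m \<in> Fm" and "\<xi>p \<in> Fp"
    and "sqrt (2 * (INF s\<in>closure O'. V s - Vmin)) * setdist Fm Fp > 2 * sqrt (2 * Vmin)"
  shows "V \<in> Sigma_class \<xi>m \<xi>p Vmin"
proof -
  define W where "W = (INF s\<in>closure O'. V s - Vmin)"
  have S: "C2_sphere V" "V \<xi>m = Vmin" "V \<xi>p = Vmin" "\<forall>s\<in>sphere 0 1. Vmin \<le> V s"
    using assms(6) by (auto simp: S_class_def)
  interpret minimal_sphere_potential \<xi>m \<xi>p Vmin V
    by unfold_locales (use S assms(2,3,5) continuous_on_C2_sphere in auto)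
  define k where "k = sqrt (2 * W) * setdist Fm Fp"
  define \<mu> where "\<mu> = 2 * sqrt (2 * Vmin)"
  have \<mu>: "0 < \<mu>" "\<mu> < k" using assms(5,12) by (auto simp: k_def \<mu>_def W_def)
  have "0 < sqrt (2 * W) * setdist Fm Fp" using \<mu> unfolding k_def by linarith
  then have "0 \<le> W" using setdist_pos_le[of Fm Fp] by (auto simp: zero_less_mult_iff)
  have O': "O' \<subseteq> sphere 0 1" using assms(7) by (auto simp: openin_subtopology)
  have W: "\<forall>s\<in>O'. Vmin + W \<le> V s"
  proof
    fix s assume s: "s \<in> O'"
    have "closure O' \<subseteq> sphere 0 1" using O' by (intro closure_minimal) auto
    then have "bdd_below ((\<lambda>s. V s - Vmin) ` closure O')" using S(4) by (intro bdd_belowI[of _ 0]) auto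
    then have "W \<le> V s - Vmin"
      unfolding W_def using s closure_subset[of O'] by (intro cINF_lower) auto
    then show "Vmin + W \<le> V s" by simp
  qed
  have "closed (sphere 0 1 - O')"
    using assms(7) by (metis closed_sphere closedin_closed_trans closedin_diff closedin_self)
  then have closed: "closed Fm" "closed Fp" using closed_components assms(8) by blast+
  have disj: "Fm \<inter> Fp = {}" using components_nonoverlap[of Fm "sphere 0 1 - O'" Fp] assms(8,9) by auto
  have cover: "sphere 0 1 - O' \<subseteq> Fm \<union> Fp" using Union_components[of "sphere 0 1 - O'"] assms(8) by auto
  \<comment> \<open>For this exponent \<open>alpha_star \<alpha>\<close> is the mean of \<open>1\<close> and \<open>\<mu> / k\<close>, so it exceeds \<open>\<mu> / k\<close> and makes one term of
    the supremum positive.\<close>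
  define \<alpha> where "\<alpha> = 1 - \<mu> / k"
  have \<alpha>: "0 < \<alpha>" "\<alpha> < 1" using \<mu> by (auto simp: \<alpha>_def)
  have as: "alpha_star \<alpha> = (1 + \<mu> / k) / 2" by (simp add: alpha_star_def \<alpha>_def)
  have as0: "0 < alpha_star \<alpha>" using \<mu> unfolding as by (simp add: add_pos_pos)
  have "\<mu> < alpha_star \<alpha> * k" unfolding as using \<mu> by (simp add: field_simps)
  then have "0 < alpha_star \<alpha> * (k - \<mu> / alpha_star \<alpha>)" using as0 by (simp add: right_diff_distrib)
  then have "0 < ereal (alpha_star \<alpha>) * ereal (k - \<mu> / alpha_star \<alpha>)" by simp
  also have "\<dots> \<le> ereal (alpha_star \<alpha>) * gam_eps0 \<xi>m \<xi>p Vmin V \<alpha>"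
    using gam_eps0_ge[OF as0 closed(1) assms(10) closed(2) assms(11) disj cover W \<open>0 \<le> W\<close>] as0
    by (intro ereal_mult_left_mono) (simp_all add: k_def \<mu>_def)
  also have "\<dots> \<le> gam_alpha0 \<xi>m \<xi>p Vmin V"
    unfolding gam_alpha0_eq_SUP[of 1, simplified] using \<alpha> by (intro SUP_upper) auto
  finally show ?thesis using assms(6) by (simp add: Sigma_class_def)
qed

end
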